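(* Let $A$ be a commutative unital ring and let $B$ be a unital $A$-algebra which is left noetherian as a ring. Suppose that for every simple left $B[X]$-module $M$ the map $\varphi\colon M\to M$, $\varphi(m)=X\cdot m$, is integral over $A$, i.e. there exist $n\ge 1$ and $z_0,\ldots,z_{n-1}\in A$ such that $\varphi^n+\sum_{j=0}^{n-1}z_j\varphi^j=0$ in $\operatorname{End}_{B[X]}(M)$. Then $B$ is a Jacobson ring, i.e. every semiprime ideal of $B$ is semiprimitive.
   Context: Rings are associative and unital, not necessarily commutative; "ideal" means two-sided ideal; modules are left modules, and simple modules are non-zero. $B[X]$ is the ring of polynomials in one central indeterminate $X$ with coefficients in $B$. For a $B[X]$-module $M$, $\operatorname{End}_{B[X]}(M)$ is an $A$-algebra via $(z\cdot\varphi)(m)=z\cdot\varphi(m)$, where $A$ acts on $M$ through the structure map $A\to B$ (whose image is central). A proper ideal $P$ of a ring $B$ is prime if for all ideals $J_1,J_2$ of $B$, $J_1J_2\subset P$ implies $J_1\subset P$ or $J_2\subset P$. For a proper ideal $I$, $\sqrt{I}$ is the intersection of all prime ideals containing $I$; the proper ideal $I$ is semiprime if $I=\sqrt{I}$. An ideal is primitive if it is the annihilator $\operatorname{Ann}_B(M)=\{b\in B: b\cdot m=0\text{ for all }m\in M\}$ of a simple $B$-module $M$. An ideal is semiprimitive if it is an intersection of primitive ideals. *)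

theory Defs
  imports "HOL-Algebra.UnivPoly" "HOL-Algebra.Ideal_Product"
begin

section \<open>Left noetherian rings\<close>

definition left_ideal :: "'r set \<Rightarrow> ('r, 'k) ring_scheme \<Rightarrow> bool" where
  "left_ideal I R \<longleftrightarrow>
     additive_subgroup I R \<and> (\<forall>r\<in>carrier R. \<forall>x\<in>I. r \<otimes>\<^bsub>R\<^esub> x \<in> I)"

definition left_noetherian :: "('r, 'k) ring_scheme \<Rightarrow> bool" where
  "left_noetherian R \<longleftrightarrow>
     (\<forall>I :: nat \<Rightarrow> 'r set.
        (\<forall>n. left_ideal (I n) R) \<and> (\<forall>n. I n \<subseteq> I (Suc n)) \<longrightarrow>
        (\<exists>N. \<forall>n\<ge>N. I n = I N))"


section \<open>Left modules\<close>

text \<open>The library locale \<^locale>\<open>module\<close> requires a commutative ring of scalars. The record type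
  \<^typ>\<open>('r, 'm) module\<close> is reused; its fields \<open>mult\<close> and \<open>one\<close> play no role.\<close>

locale left_module = R?: ring R + M?: abelian_group M
  for R :: "('r, 'k) ring_scheme" (structure) and M :: "('r, 'm, 'l) module_scheme" (structure) +
  assumes lsmult_closed:
      "\<lbrakk>a \<in> carrier R; x \<in> carrier M\<rbrakk> \<Longrightarrow> a \<odot>\<^bsub>M\<^esub> x \<in> carrier M"
    and lsmult_l_distr:
      "\<lbrakk>a \<in> carrier R; b \<in> carrier R; x \<in> carrier M\<rbrakk> \<Longrightarrow>
       (a \<oplus>\<^bsub>R\<^esub> b) \<odot>\<^bsub>M\<^esub> x = a \<odot>\<^bsub>M\<^esub> x \<oplus>\<^bsub>M\<^esub> b \<odot>\<^bsub>M\<^esub> x"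
    and lsmult_r_distr:
      "\<lbrakk>a \<in> carrier R; x \<in> carrier M; y \<in> carrier M\<rbrakk> \<Longrightarrow>
       a \<odot>\<^bsub>M\<^esub> (x \<oplus>\<^bsub>M\<^esub> y) = a \<odot>\<^bsub>M\<^esub> x \<oplus>\<^bsub>M\<^esub> a \<odot>\<^bsub>M\<^esub> y"
    and lsmult_assoc:
      "\<lbrakk>a \<in> carrier R; b \<in> carrier R; x \<in> carrier M\<rbrakk> \<Longrightarrow>
       (a \<otimes>\<^bsub>R\<^esub> b) \<odot>\<^bsub>M\<^esub> x = a \<odot>\<^bsub>M\<^esub> (b \<odot>\<^bsub>M\<^esub> x)"
    and lsmult_one:
      "x \<in> carrier M \<Longrightarrow> \<one>\<^bsub>R\<^esub> \<odot>\<^bsub>M\<^esub> x = x"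

definition simple_left_module ::
  "('r, 'k) ring_scheme \<Rightarrow> ('r, 'm, 'l) module_scheme \<Rightarrow> bool" where
  "simple_left_module R M \<longleftrightarrow>
     left_module R M \<and> carrier M \<noteq> {\<zero>\<^bsub>M\<^esub>} \<and>
     (\<forall>N. submodule N R M \<longrightarrow> N = {\<zero>\<^bsub>M\<^esub>} \<or> N = carrier M)"

definition annihilator :: "('r, 'k) ring_scheme \<Rightarrow> ('r, 'm, 'l) module_scheme \<Rightarrow> 'r set" where
  "annihilator R M = {b \<in> carrier R. \<forall>m\<in>carrier M. b \<odot>\<^bsub>M\<^esub> m = \<zero>\<^bsub>M\<^esub>}"

definition left_module_hom ::
  "('r, 'k) ring_scheme \<Rightarrow> ('r, 'm, 'l) module_scheme \<Rightarrow> ('r, 'n, 'j) module_scheme \<Rightarrow> ('m \<Rightarrow> 'n) set" where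
  "left_module_hom R M N =
     {f \<in> carrier M \<rightarrow> carrier N.
        (\<forall>x\<in>carrier M. \<forall>y\<in>carrier M. f (x \<oplus>\<^bsub>M\<^esub> y) = f x \<oplus>\<^bsub>N\<^esub> f y) \<and>
        (\<forall>r\<in>carrier R. \<forall>x\<in>carrier M. f (r \<odot>\<^bsub>M\<^esub> x) = r \<odot>\<^bsub>N\<^esub> f x)}"


section \<open>Endomorphism algebras and integrality\<close>

text \<open>The endomorphisms of the \<open>R\<close>-module \<open>M\<close>, with scalars acting through a structure map
  \<open>\<sigma>\<close> from the commutative ring of scalars to \<open>R\<close>. Endomorphisms are made extensional so that equality
  in the algebra is equality on \<open>carrier M\<close>.\<close>

definition End_algebra ::
  "('r, 'k) ring_scheme \<Rightarrow> ('a \<Rightarrow> 'r) \<Rightarrow> ('r, 'm, 'l) module_scheme \<Rightarrow> ('a, 'm \<Rightarrow> 'm) module" where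
  "End_algebra R \<sigma> M =
     \<lparr>carrier = left_module_hom R M M \<inter> extensional (carrier M),
      mult = compose (carrier M),
      one = (\<lambda>m\<in>carrier M. m),
      zero = (\<lambda>m\<in>carrier M. \<zero>\<^bsub>M\<^esub>),
      add = (\<lambda>f g. \<lambda>m\<in>carrier M. f m \<oplus>\<^bsub>M\<^esub> g m),
      smult = (\<lambda>z f. \<lambda>m\<in>carrier M. \<sigma> z \<odot>\<^bsub>M\<^esub> f m)\<rparr>"

definition integral_over ::
  "('a, 'k) ring_scheme \<Rightarrow> ('a, 'e, 'l) module_scheme \<Rightarrow> 'e \<Rightarrow> bool" where
  "integral_over A E f \<longleftrightarrow>
     (\<exists>n::nat. n \<ge> 1 \<and>
       (\<exists>z \<in> {..<n} \<rightarrow> carrier A.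
          f [^]\<^bsub>E\<^esub> n \<oplus>\<^bsub>E\<^esub> (\<Oplus>\<^bsub>E\<^esub>j\<in>{..<n}. z j \<odot>\<^bsub>E\<^esub> (f [^]\<^bsub>E\<^esub> j)) = \<zero>\<^bsub>E\<^esub>))"


section \<open>Prime, semiprime, primitive and semiprimitive ideals\<close>

text \<open>The library locale \<^locale>\<open>primeideal\<close> is the elementwise notion for commutative rings.\<close>

definition prime_ideal :: "'r set \<Rightarrow> ('r, 'k) ring_scheme \<Rightarrow> bool" where
  "prime_ideal P R \<longleftrightarrow>
     ideal P R \<and> P \<noteq> carrier R \<and>
     (\<forall>J\<^sub>1 J\<^sub>2. ideal J\<^sub>1 R \<and> ideal J\<^sub>2 R \<and> J\<^sub>1 \<cdot>\<^bsub>R\<^esub> J\<^sub>2 \<subseteq> P \<longrightarrow> J\<^sub>1 \<subseteq> P \<or> J\<^sub>2 \<subseteq> P)"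

definition ideal_radical :: "('r, 'k) ring_scheme \<Rightarrow> 'r set \<Rightarrow> 'r set" where
  "ideal_radical R I = carrier R \<inter> \<Inter>{P. prime_ideal P R \<and> I \<subseteq> P}"

definition semiprime_ideal :: "'r set \<Rightarrow> ('r, 'k) ring_scheme \<Rightarrow> bool" where
  "semiprime_ideal I R \<longleftrightarrow> ideal I R \<and> I \<noteq> carrier R \<and> I = ideal_radical R I"

text \<open>Fixing the type of the module to \<^typ>\<open>('r, 'r set) module\<close> is no restriction, by
  \<open>simple_left_module_copy\<close> and \<open>primitive_ideal_annihilator\<close> below.\<close>

definition primitive_ideal :: "'r set \<Rightarrow> ('r, 'k) ring_scheme \<Rightarrow> bool" where
  "primitive_ideal P R \<longleftrightarrow>
     ideal P R \<and>
     (\<exists>M :: ('r, 'r set) module. simple_left_module R M \<and> P = annihilator R M)"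

definition semiprimitive_ideal :: "'r set \<Rightarrow> ('r, 'k) ring_scheme \<Rightarrow> bool" where
  "semiprimitive_ideal I R \<longleftrightarrow>
     ideal I R \<and> (\<exists>\<P>. (\<forall>P\<in>\<P>. primitive_ideal P R) \<and> I = carrier R \<inter> \<Inter>\<P>)"

definition jacobson_ring :: "('r, 'k) ring_scheme \<Rightarrow> bool" where
  "jacobson_ring R \<longleftrightarrow> ring R \<and> (\<forall>I. semiprime_ideal I R \<longrightarrow> semiprimitive_ideal I R)"


section \<open>Polynomials\<close>

text \<open>\<^term>\<open>UP B\<close> is \<open>B[X]\<close> with \<open>X\<close> commuting with coefficients; it is a ring for every ring \<open>B\<close>.\<close>

definition UP_X :: "('b, 'k) ring_scheme \<Rightarrow> nat \<Rightarrow> 'b" where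
  "UP_X B = monom (UP B) \<one>\<^bsub>B\<^esub> 1"

definition UP_const :: "('b, 'k) ring_scheme \<Rightarrow> 'b \<Rightarrow> nat \<Rightarrow> 'b" where
  "UP_const B b = monom (UP B) b 0"


section \<open>Every simple module has a copy whose elements are sets of scalars\<close>

text \<open>The witness is \<open>R / Ann(m)\<close> for a nonzero \<open>m\<close>: its cosets are the fibres of \<open>r \<mapsto> r \<cdot> m\<close>.
  Hence a hypothesis on all simple left \<open>R\<close>-modules loses nothing when it only quantifies over modules
  of type \<^typ>\<open>('r, 'r set) module\<close>; for \<^term>\<open>UP B\<close> the elements have type \<^typ>\<open>(nat \<Rightarrow> 'b) set\<close>.\<close>

lemma (in left_module) lsmult_zero_l:
  assumes "x \<in> carrier M"
  shows "\<zero>\<^bsub>R\<^esub> \<odot>\<^bsub>M\<^esub> x = \<zero>\<^bsub>M\<^esub>"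
proof -
  have "\<zero>\<^bsub>R\<^esub> \<odot>\<^bsub>M\<^esub> x \<oplus>\<^bsub>M\<^esub> \<zero>\<^bsub>R\<^esub> \<odot>\<^bsub>M\<^esub> x = \<zero>\<^bsub>R\<^esub> \<odot>\<^bsub>M\<^esub> x"
    using lsmult_l_distr[of "\<zero>\<^bsub>R\<^esub>" "\<zero>\<^bsub>R\<^esub>" x] assms by simp
  then show ?thesis
    using assms by (metis M.add.l_cancel_one R.zero_closed lsmult_closed)
qed

lemma (in left_module) lsmult_minus_l:
  assumes "a \<in> carrier R" "x \<in> carrier M"
  shows "(\<ominus>\<^bsub>R\<^esub> a) \<odot>\<^bsub>M\<^esub> x = \<ominus>\<^bsub>M\<^esub> (a \<odot>\<^bsub>M\<^esub> x)"
proof -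
  have "(\<ominus>\<^bsub>R\<^esub> a) \<odot>\<^bsub>M\<^esub> x \<oplus>\<^bsub>M\<^esub> a \<odot>\<^bsub>M\<^esub> x = \<zero>\<^bsub>M\<^esub>"
    using lsmult_l_distr[of "\<ominus>\<^bsub>R\<^esub> a" a x] assms by (simp add: R.l_neg lsmult_zero_l)
  then show ?thesis
    using assms by (simp add: M.minus_equality lsmult_closed)
qed

lemma (in left_module) cyclic_submodule:
  assumes "m \<in> carrier M"
  shows "submodule ((\<lambda>r. r \<odot>\<^bsub>M\<^esub> m) ` carrier R) R M"
proof (intro submodule.intro submodule_axioms.intro subgroup.intro)
  show "(\<lambda>r. r \<odot>\<^bsub>M\<^esub> m) ` carrier R \<subseteq> carrier (add_monoid M)"
    using assms by (auto simp: lsmult_closed)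
next
  fix x y
  assume "x \<in> (\<lambda>r. r \<odot>\<^bsub>M\<^esub> m) ` carrier R" "y \<in> (\<lambda>r. r \<odot>\<^bsub>M\<^esub> m) ` carrier R"
  then obtain r s where rs: "r \<in> carrier R" "x = r \<odot>\<^bsub>M\<^esub> m" "s \<in> carrier R" "y = s \<odot>\<^bsub>M\<^esub> m"
    by auto
  then show "x \<otimes>\<^bsub>add_monoid M\<^esub> y \<in> (\<lambda>r. r \<odot>\<^bsub>M\<^esub> m) ` carrier R"
    using assms by (auto simp: lsmult_l_distr intro!: image_eqI[of _ _ "r \<oplus>\<^bsub>R\<^esub> s"])
next
  show "\<one>\<^bsub>add_monoid M\<^esub> \<in> (\<lambda>r. r \<odot>\<^bsub>M\<^esub> m) ` carrier R"
    using assms by (auto simp: lsmult_zero_l intro!: image_eqI[of _ _ "\<zero>\<^bsub>R\<^esub>"])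
next
  fix x
  assume "x \<in> (\<lambda>r. r \<odot>\<^bsub>M\<^esub> m) ` carrier R"
  then obtain r where r: "r \<in> carrier R" "x = r \<odot>\<^bsub>M\<^esub> m"
    by auto
  then show "inv\<^bsub>add_monoid M\<^esub> x \<in> (\<lambda>r. r \<odot>\<^bsub>M\<^esub> m) ` carrier R"
    using assms lsmult_minus_l[of r m]
    by (auto simp: a_inv_def[symmetric] intro!: image_eqI[of _ _ "\<ominus>\<^bsub>R\<^esub> r"])
next
  fix a x
  assume "a \<in> carrier R" and "x \<in> (\<lambda>r. r \<odot>\<^bsub>M\<^esub> m) ` carrier R"
  then obtain r where "a \<in> carrier R" "r \<in> carrier R" "x = r \<odot>\<^bsub>M\<^esub> m"
    by auto
  then show "a \<odot>\<^bsub>M\<^esub> x \<in> (\<lambda>r. r \<odot>\<^bsub>M\<^esub> m) ` carrier R"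
    using assms by (auto simp: lsmult_assoc intro!: image_eqI[of _ _ "a \<otimes>\<^bsub>R\<^esub> r"])
qed

lemma left_module_transport:
  fixes M :: "('r, 'm, 'l) module_scheme" and f :: "'m \<Rightarrow> 'n"
  assumes M: "left_module R M" and inj: "inj_on f (carrier M)"
  defines "g \<equiv> inv_into (carrier M) f"
  defines "N \<equiv> \<lparr>carrier = f ` carrier M, mult = undefined, one = undefined, zero = f \<zero>\<^bsub>M\<^esub>,
                add = (\<lambda>x y. f (g x \<oplus>\<^bsub>M\<^esub> g y)), smult = (\<lambda>r x. f (r \<odot>\<^bsub>M\<^esub> g x))\<rparr>"
  shows "left_module R N \<and> f \<in> left_module_hom R M N \<and> bij_betw f (carrier M) (carrier N)"
proof -
  interpret left_module R M by fact
  have g: "g (f x) = x" if "x \<in> carrier M" for x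
    using inj that by (simp add: g_def)
  have "abelian_group N"
  proof (rule abelian_groupI)
    fix x assume "x \<in> carrier N"
    then obtain u where u: "u \<in> carrier M" "x = f u"
      by (auto simp: N_def)
    then show "\<exists>y\<in>carrier N. y \<oplus>\<^bsub>N\<^esub> x = \<zero>\<^bsub>N\<^esub>"
      by (auto simp: N_def g M.l_neg intro!: bexI[of _ "\<ominus>\<^bsub>M\<^esub> u"])
  qed (auto simp: N_def g M.a_ac)
  then have "left_module R N"
    by (intro left_module.intro left_module_axioms.intro R.ring_axioms)
      (auto simp: N_def g lsmult_closed lsmult_l_distr lsmult_r_distr lsmult_assoc lsmult_one)
  moreover have "f \<in> left_module_hom R M N"
    by (auto simp: left_module_hom_def N_def g)
  ultimately show ?thesis
    using inj by (auto simp: bij_betw_def N_def)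
qed

theorem simple_left_module_copy:
  fixes R :: "('r, 'k) ring_scheme" and M :: "('r, 'm, 'l) module_scheme"
  assumes "simple_left_module R M"
  shows "\<exists>(N :: ('r, 'r set) module) f. simple_left_module R N \<and>
           f \<in> left_module_hom R M N \<and> bij_betw f (carrier M) (carrier N)"
proof -
  interpret left_module R M
    using assms by (simp add: simple_left_module_def)
  obtain m where m: "m \<in> carrier M" "m \<noteq> \<zero>\<^bsub>M\<^esub>"
    using assms by (auto simp: simple_left_module_def)
  have "m \<in> (\<lambda>r. r \<odot>\<^bsub>M\<^esub> m) ` carrier R"
    using m by (auto simp: lsmult_one intro!: image_eqI[of _ _ "\<one>\<^bsub>R\<^esub>"])
  then have onto: "(\<lambda>r. r \<odot>\<^bsub>M\<^esub> m) ` carrier R = carrier M"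
    using assms cyclic_submodule[OF m(1)] m(2) unfolding simple_left_module_def by (metis singletonD)
  define f where "f = (\<lambda>x. {r \<in> carrier R. r \<odot>\<^bsub>M\<^esub> m = x})"
  have "inj_on f (carrier M)"
  proof (rule inj_onI)
    fix x y assume x: "x \<in> carrier M" and eq: "f x = f y"
    from x have "x \<in> (\<lambda>r. r \<odot>\<^bsub>M\<^esub> m) ` carrier R"
      by (simp only: onto)
    then obtain r where "r \<in> carrier R" "r \<odot>\<^bsub>M\<^esub> m = x"
      by (elim imageE) simp
    then have "r \<in> f x"
      by (simp add: f_def)
    then have "r \<odot>\<^bsub>M\<^esub> m = y"
      unfolding eq by (simp add: f_def)
    with \<open>r \<odot>\<^bsub>M\<^esub> m = x\<close> show "x = y"
      by simp
  qed
  from left_module_transport[OF left_module_axioms this]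
  obtain N :: "('r, 'r set) module"
    where N: "left_module R N" "f \<in> left_module_hom R M N" "bij_betw f (carrier M) (carrier N)"
    by blast
  interpret N: left_module R N by fact
  have f_add: "f (x \<oplus>\<^bsub>M\<^esub> y) = f x \<oplus>\<^bsub>N\<^esub> f y" if "x \<in> carrier M" "y \<in> carrier M" for x y
    using N(2) that by (auto simp: left_module_hom_def)
  have f_smult: "f (r \<odot>\<^bsub>M\<^esub> x) = r \<odot>\<^bsub>N\<^esub> f x" if "r \<in> carrier R" "x \<in> carrier M" for r x
    using N(2) that by (auto simp: left_module_hom_def)
  have f_closed: "f x \<in> carrier N" if "x \<in> carrier M" for x
    using N(3) that by (auto simp: bij_betw_def)
  have f_zero: "f \<zero>\<^bsub>M\<^esub> = \<zero>\<^bsub>N\<^esub>"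
    using f_smult[of "\<zero>\<^bsub>R\<^esub>" "\<zero>\<^bsub>M\<^esub>"] f_closed by (simp add: lsmult_zero_l N.lsmult_zero_l)
  have f_minus: "f (\<ominus>\<^bsub>M\<^esub> x) = \<ominus>\<^bsub>N\<^esub> f x" if "x \<in> carrier M" for x
    using f_smult[of "\<ominus>\<^bsub>R\<^esub> \<one>\<^bsub>R\<^esub>" x] that f_closed
    by (simp add: lsmult_minus_l lsmult_one N.lsmult_minus_l N.lsmult_one)
  have inj: "inj_on f (carrier M)" and im: "f ` carrier M = carrier N"
    using N(3) by (auto simp: bij_betw_def)
  have "carrier N \<noteq> {\<zero>\<^bsub>N\<^esub>}"
    using m f_closed[OF m(1)] inj f_zero by (metis M.zero_closed inj_onD singletonD)
  moreover have "U = {\<zero>\<^bsub>N\<^esub>} \<or> U = carrier N" if U: "submodule U R N" for U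
  proof -
    define V where "V = {x \<in> carrier M. f x \<in> U}"
    interpret U: submodule U R N by fact
    have "submodule V R M"
    proof (intro submodule.intro submodule_axioms.intro subgroup.intro)
      show "V \<subseteq> carrier (add_monoid M)"
        by (auto simp: V_def)
      show "\<one>\<^bsub>add_monoid M\<^esub> \<in> V"
        using U.one_closed by (simp add: V_def f_zero)
    next
      fix x y assume "x \<in> V" "y \<in> V"
      then show "x \<otimes>\<^bsub>add_monoid M\<^esub> y \<in> V"
        using U.m_closed by (simp add: V_def f_add)
    next
      fix x assume "x \<in> V"
      then show "inv\<^bsub>add_monoid M\<^esub> x \<in> V"
        using U.m_inv_closed[of "f x"] by (simp add: V_def f_minus a_inv_def[symmetric])
    next
      fix a x assume "a \<in> carrier R" "x \<in> V"
      then show "a \<odot>\<^bsub>M\<^esub> x \<in> V"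
        using U.smult_closed by (simp add: V_def f_smult lsmult_closed)
    qed
    then have "V = {\<zero>\<^bsub>M\<^esub>} \<or> V = carrier M"
      using assms by (simp add: simple_left_module_def)
    moreover have "U = f ` V"
    proof -
      have "U \<subseteq> f ` carrier M"
        using U.subset im by simp
      then show ?thesis
        unfolding V_def by blast
    qed
    ultimately show ?thesis
      using im f_zero by auto
  qed
  ultimately show ?thesis
    using N by (auto simp: simple_left_module_def)
qed

lemma (in left_module) annihilator_ideal: "ideal (annihilator R M) R"
proof (rule idealI)
  show "subgroup (annihilator R M) (add_monoid R)"
    by (rule subgroup.intro)
      (auto simp: annihilator_def lsmult_l_distr lsmult_zero_l lsmult_minus_l a_inv_def[symmetric])
next
  fix a x assume "a \<in> annihilator R M" "x \<in> carrier R"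
  then show "x \<otimes>\<^bsub>R\<^esub> a \<in> annihilator R M" "a \<otimes>\<^bsub>R\<^esub> x \<in> annihilator R M"
    using lsmult_r_distr[of x "\<zero>\<^bsub>M\<^esub>" "\<zero>\<^bsub>M\<^esub>"] lsmult_closed[of x "\<zero>\<^bsub>M\<^esub>"]
    by (auto simp: annihilator_def lsmult_assoc lsmult_closed)
qed (rule R.ring_axioms)

theorem primitive_ideal_annihilator:
  fixes R :: "('r, 'k) ring_scheme" and M :: "('r, 'm, 'l) module_scheme"
  assumes "simple_left_module R M"
  shows "primitive_ideal (annihilator R M) R"
proof -
  obtain N :: "('r, 'r set) module" and f where N: "simple_left_module R N"
    and f: "f \<in> left_module_hom R M N" "bij_betw f (carrier M) (carrier N)"
    using simple_left_module_copy[OF assms] by blast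
  interpret left_module R M
    using assms by (simp add: simple_left_module_def)
  interpret N: left_module R N
    using N by (simp add: simple_left_module_def)
  have f_smult: "f (r \<odot>\<^bsub>M\<^esub> x) = r \<odot>\<^bsub>N\<^esub> f x" if "r \<in> carrier R" "x \<in> carrier M" for r x
    using f(1) that by (auto simp: left_module_hom_def)
  have im: "carrier N = f ` carrier M" and inj: "inj_on f (carrier M)"
    using f(2) by (auto simp: bij_betw_def)
  have f_zero: "f \<zero>\<^bsub>M\<^esub> = \<zero>\<^bsub>N\<^esub>"
    using f_smult[of "\<zero>\<^bsub>R\<^esub>" "\<zero>\<^bsub>M\<^esub>"] by (simp add: lsmult_zero_l N.lsmult_zero_l im)
  have "r \<odot>\<^bsub>M\<^esub> x = \<zero>\<^bsub>M\<^esub> \<longleftrightarrow> r \<odot>\<^bsub>N\<^esub> f x = \<zero>\<^bsub>N\<^esub>" if "r \<in> carrier R" "x \<in> carrier M" for r x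
    using inj_on_eq_iff[OF inj, of "r \<odot>\<^bsub>M\<^esub> x" "\<zero>\<^bsub>M\<^esub>"] that
    by (simp add: f_smult f_zero lsmult_closed)
  then have "annihilator R M = annihilator R N"
    by (auto simp: annihilator_def im)
  then show ?thesis
    using N annihilator_ideal unfolding primitive_ideal_def by blast
qed


section \<open>The endomorphism algebra is a ring, and multiplication by \<open>X\<close> belongs to it\<close>

lemma End_algebra_ring:
  fixes R :: "('r, 'k) ring_scheme" and M :: "('r, 'm, 'l) module_scheme" and \<sigma> :: "'a \<Rightarrow> 'r"
  assumes "left_module R M"
  shows "ring (End_algebra R \<sigma> M)"
proof -
  interpret left_module R M by fact
  let ?E = "End_algebra R \<sigma> M"
  have smult_zero: "r \<odot>\<^bsub>M\<^esub> \<zero>\<^bsub>M\<^esub> = \<zero>\<^bsub>M\<^esub>" if "r \<in> carrier R" for r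
    using lsmult_r_distr[of r "\<zero>\<^bsub>M\<^esub>" "\<zero>\<^bsub>M\<^esub>"] lsmult_closed[of r "\<zero>\<^bsub>M\<^esub>"] that by simp
  have smult_minus: "r \<odot>\<^bsub>M\<^esub> (\<ominus>\<^bsub>M\<^esub> x) = \<ominus>\<^bsub>M\<^esub> (r \<odot>\<^bsub>M\<^esub> x)"
    if "r \<in> carrier R" "x \<in> carrier M" for r x
    using lsmult_r_distr[of r "\<ominus>\<^bsub>M\<^esub> x" x] that
    by (simp add: M.l_neg smult_zero M.minus_equality lsmult_closed)
  have closed: "f x \<in> carrier M" if "f \<in> carrier ?E" "x \<in> carrier M" for f x
    using that by (auto simp: End_algebra_def left_module_hom_def)
  have add: "f (x \<oplus>\<^bsub>M\<^esub> y) = f x \<oplus>\<^bsub>M\<^esub> f y"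
    if "f \<in> carrier ?E" "x \<in> carrier M" "y \<in> carrier M" for f x y
    using that by (auto simp: End_algebra_def left_module_hom_def)
  have scal: "f (r \<odot>\<^bsub>M\<^esub> x) = r \<odot>\<^bsub>M\<^esub> f x"
    if "f \<in> carrier ?E" "r \<in> carrier R" "x \<in> carrier M" for f r x
    using that by (auto simp: End_algebra_def left_module_hom_def)
  have eqI: "f = g" if "f \<in> extensional (carrier M)" "g \<in> extensional (carrier M)"
    "\<And>x. x \<in> carrier M \<Longrightarrow> f x = g x" for f g :: "'m \<Rightarrow> 'm"
    using that by (rule extensionalityI)
  have ext: "f \<in> extensional (carrier M)" if "f \<in> carrier ?E" for f
    using that by (auto simp: End_algebra_def)
  have memI: "f \<in> carrier ?E"
    if "f \<in> extensional (carrier M)" "\<And>x. x \<in> carrier M \<Longrightarrow> f x \<in> carrier M"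
      "\<And>x y. \<lbrakk>x \<in> carrier M; y \<in> carrier M\<rbrakk> \<Longrightarrow> f (x \<oplus>\<^bsub>M\<^esub> y) = f x \<oplus>\<^bsub>M\<^esub> f y"
      "\<And>r x. \<lbrakk>r \<in> carrier R; x \<in> carrier M\<rbrakk> \<Longrightarrow> f (r \<odot>\<^bsub>M\<^esub> x) = r \<odot>\<^bsub>M\<^esub> f x" for f
    using that by (auto simp: End_algebra_def left_module_hom_def)
  have simps: "mult ?E = compose (carrier M)" "one ?E = (\<lambda>m\<in>carrier M. m)"
    "zero ?E = (\<lambda>m\<in>carrier M. \<zero>\<^bsub>M\<^esub>)" "add ?E = (\<lambda>f g. \<lambda>m\<in>carrier M. f m \<oplus>\<^bsub>M\<^esub> g m)"
    by (simp_all add: End_algebra_def)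
  have add_mem: "f \<oplus>\<^bsub>?E\<^esub> g \<in> carrier ?E" if "f \<in> carrier ?E" "g \<in> carrier ?E" for f g
    using that
    by (intro memI) (auto simp: simps closed add scal lsmult_closed lsmult_r_distr M.a_ac)
  have mult_mem: "f \<otimes>\<^bsub>?E\<^esub> g \<in> carrier ?E" if "f \<in> carrier ?E" "g \<in> carrier ?E" for f g
    using that
    by (intro memI) (auto simp: simps compose_def closed add scal lsmult_closed)
  have zero_mem: "\<zero>\<^bsub>?E\<^esub> \<in> carrier ?E"
    by (intro memI) (auto simp: simps lsmult_closed smult_zero)
  have one_mem: "\<one>\<^bsub>?E\<^esub> \<in> carrier ?E"
    by (intro memI) (auto simp: simps lsmult_closed)
  have minus_mem: "(\<lambda>m\<in>carrier M. \<ominus>\<^bsub>M\<^esub> f m) \<in> carrier ?E" if "f \<in> carrier ?E" for f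
    using that
    by (intro memI) (auto simp: closed add scal lsmult_closed smult_minus M.minus_add)
  have "abelian_group ?E"
  proof (rule abelian_groupI)
    fix f assume f: "f \<in> carrier ?E"
    show "\<exists>g\<in>carrier ?E. g \<oplus>\<^bsub>?E\<^esub> f = \<zero>\<^bsub>?E\<^esub>"
      using f by (intro bexI[OF _ minus_mem[OF f]]) (auto simp: simps closed M.l_neg intro!: eqI)
    show "\<zero>\<^bsub>?E\<^esub> \<oplus>\<^bsub>?E\<^esub> f = f"
      using f ext[OF f] by (intro eqI) (auto simp: simps closed)
  qed (auto simp: add_mem zero_mem, auto simp: simps closed M.a_ac intro!: eqI)
  moreover have "monoid ?E"
  proof (rule monoidI)
    fix f assume f: "f \<in> carrier ?E"
    show "\<one>\<^bsub>?E\<^esub> \<otimes>\<^bsub>?E\<^esub> f = f" "f \<otimes>\<^bsub>?E\<^esub> \<one>\<^bsub>?E\<^esub> = f"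
      using f ext[OF f] by (auto simp: simps closed compose_def intro!: eqI)
  qed (auto simp: mult_mem one_mem, auto simp: simps closed compose_def intro!: eqI)
  ultimately show ?thesis
    by (rule ringI) (auto simp: simps closed compose_def add intro!: eqI)
qed

lemma UP_X_mult_endomorphism:
  fixes B :: "('b, 'k) ring_scheme" and M :: "(nat \<Rightarrow> 'b, 'm, 'l) module_scheme"
  assumes "ring B" and "left_module (UP B) M"
  shows "(\<lambda>m\<in>carrier M. UP_X B \<odot>\<^bsub>M\<^esub> m) \<in> carrier (End_algebra (UP B) \<sigma> M)"
proof -
  interpret B: ring B by fact
  interpret P: UP_ring B "UP B" by unfold_locales simp
  interpret M: left_module "UP B" M by fact
  have X: "UP_X B \<in> carrier (UP B)"
    by (simp add: UP_X_def)
  have comm: "p \<otimes>\<^bsub>UP B\<^esub> UP_X B = UP_X B \<otimes>\<^bsub>UP B\<^esub> p" if "p \<in> carrier (UP B)" for p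
  proof (rule P.up_eqI)
    fix n
    let ?c = "\<lambda>i. coeff (UP B) p i" and ?X = "\<lambda>i. coeff (UP B) (UP_X B) i"
    have c: "?c i \<in> carrier B" for i
      using that by simp
    have X_i: "?X i = (if i = 1 then \<one>\<^bsub>B\<^esub> else \<zero>\<^bsub>B\<^esub>)" for i
      by (simp add: UP_X_def)
    show "coeff (UP B) (p \<otimes>\<^bsub>UP B\<^esub> UP_X B) n = coeff (UP B) (UP_X B \<otimes>\<^bsub>UP B\<^esub> p) n"
    proof (cases n)
      case 0
      then show ?thesis
        using that X c by (simp add: X_i)
    next
      case (Suc k)
      have "(\<Oplus>\<^bsub>B\<^esub>i\<in>{..n}. ?c i \<otimes>\<^bsub>B\<^esub> ?X (n - i)) = (\<Oplus>\<^bsub>B\<^esub>i\<in>{..n}. if k = i then ?c i else \<zero>\<^bsub>B\<^esub>)"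
        using Suc c by (intro B.finsum_cong') (auto simp: X_i)
      also have "\<dots> = ?c k"
        using Suc c by (intro B.finsum_singleton) auto
      also have "\<dots> = (\<Oplus>\<^bsub>B\<^esub>i\<in>{..n}. if 1 = i then ?c (n - i) else \<zero>\<^bsub>B\<^esub>)"
        using Suc c B.finsum_singleton[of 1 "{..n}" "\<lambda>i. ?c (n - i)"] by simp
      also have "\<dots> = (\<Oplus>\<^bsub>B\<^esub>i\<in>{..n}. ?X i \<otimes>\<^bsub>B\<^esub> ?c (n - i))"
        using Suc c by (intro B.finsum_cong') (auto simp: X_i)
      finally show ?thesis
        using that X by simp
    qed
  qed (use that X in simp_all)
  show ?thesis
    using X by (auto simp: End_algebra_def left_module_hom_def M.lsmult_closed M.lsmult_r_distr
        M.lsmult_assoc[symmetric] comm)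
qed

end

theory Submission
  imports Defs
begin

text \<open>It suffices that every prime ideal \<open>P\<close> is the intersection \<open>N\<close> of the primitive ideals
  containing it. By Levitzki's theorem an ideal of a left noetherian ring that is nil modulo \<open>P\<close>
  lies in \<open>P\<close>, so it is enough that each \<open>s \<in> N\<close> is nilpotent modulo \<open>P\<close>. If it is not, then
  \<open>B[X](1 - sX) + P[X]\<close> is a proper left ideal; let \<open>L\<close> be a maximal left ideal containing it and
  \<open>m\<close> the class of \<open>1\<close> in \<open>B[X]/L\<close>, so that \<open>sXm = m\<close>. Multiplying an integral equation of degree
  \<open>n\<close> for \<open>X\<close> by \<open>s\<^sup>n\<close> and applying it to \<open>m\<close> gives \<open>(1 + us)m = 0\<close> for some \<open>u \<in> B\<close>. But \<open>1 + us\<close>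
  is left invertible modulo \<open>P\<close> because \<open>us \<in> N\<close>, and \<open>P\<close> kills \<open>m\<close>, so \<open>m = 0\<close>, a contradiction.\<close>

section \<open>Maximal left ideals and simple quotients\<close>

definition maximal_left_ideal :: "'r set \<Rightarrow> ('r, 'k) ring_scheme \<Rightarrow> bool" where
  "maximal_left_ideal L R \<longleftrightarrow>
     left_ideal L R \<and> L \<noteq> carrier R \<and>
     (\<forall>K. left_ideal K R \<and> L \<subseteq> K \<longrightarrow> K = L \<or> K = carrier R)"

context ring
begin

lemma left_idealI:
  assumes "L \<subseteq> carrier R" and "\<zero> \<in> L"
    and "\<And>x y. \<lbrakk>x \<in> L; y \<in> L\<rbrakk> \<Longrightarrow> x \<oplus> y \<in> L"
    and "\<And>r x. \<lbrakk>r \<in> carrier R; x \<in> L\<rbrakk> \<Longrightarrow> r \<otimes> x \<in> L"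
  shows "left_ideal L R"
proof -
  \<comment> \<open>Additive inverses need no separate assumption: \<open>\<ominus> x\<close> is the
    multiple of \<open>x\<close> by \<open>\<ominus> \<one>\<close>.\<close>
  have "\<ominus> x \<in> L" if "x \<in> L" for x
    using assms(1) assms(4)[of "\<ominus> \<one>" x] that by (auto simp: l_minus)
  then have "subgroup L (add_monoid R)"
    using assms by (intro subgroup.intro) (auto simp: a_inv_def)
  then show ?thesis
    using assms(4) by (auto simp: left_ideal_def additive_subgroup_def)
qed

lemma left_idealD:
  assumes "left_ideal L R"
  shows "L \<subseteq> carrier R" and "\<zero> \<in> L"
    and "\<And>x y. \<lbrakk>x \<in> L; y \<in> L\<rbrakk> \<Longrightarrow> x \<oplus> y \<in> L"
    and "\<And>x y. \<lbrakk>x \<in> L; y \<in> L\<rbrakk> \<Longrightarrow> x \<ominus> y \<in> L"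
    and "\<And>r x. \<lbrakk>r \<in> carrier R; x \<in> L\<rbrakk> \<Longrightarrow> r \<otimes> x \<in> L"
proof -
  interpret additive_subgroup L R
    using assms by (simp add: left_ideal_def)
  show "L \<subseteq> carrier R" "\<zero> \<in> L"
    by (auto simp: a_subset)
  show "x \<oplus> y \<in> L" if "x \<in> L" "y \<in> L" for x y
    using that by simp
  show "x \<ominus> y \<in> L" if "x \<in> L" "y \<in> L" for x y
    using that by (simp add: a_minus_def)
  show "r \<otimes> x \<in> L" if "r \<in> carrier R" "x \<in> L" for r x
    using assms that by (simp add: left_ideal_def)
qed

lemma left_ideal_eq_carrier_iff:
  assumes "left_ideal L R"
  shows "L = carrier R \<longleftrightarrow> \<one> \<in> L"
  using left_idealD(1)[OF assms] left_idealD(5)[OF assms, of _ \<one>] by auto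

lemma left_ideal_idealI: "ideal I R \<Longrightarrow> left_ideal I R"
  by (simp add: left_ideal_def ideal.axioms(1) ideal.I_l_closed)

text \<open>The sum \<open>R u + L\<close>, kept as an explicit set so that membership of
  \<open>\<one>\<close> unfolds to an equation. It serves twice: for
  \<open>\<one> \<oplus> t\<close> over an ideal of \<open>R\<close>, and for 1 - sX over the
  polynomials with coefficients in an ideal.\<close>

lemma left_ideal_principal_add:
  assumes "left_ideal L R" and "u \<in> carrier R"
  shows "left_ideal {r \<otimes> u \<oplus> x | r x. r \<in> carrier R \<and> x \<in> L} R"
    and "L \<subseteq> {r \<otimes> u \<oplus> x | r x. r \<in> carrier R \<and> x \<in> L}"
    and "u \<in> {r \<otimes> u \<oplus> x | r x. r \<in> carrier R \<and> x \<in> L}"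
proof -
  define K where "K = {r \<otimes> u \<oplus> x | r x. r \<in> carrier R \<and> x \<in> L}"
  note L = left_idealD[OF assms(1)]
  have K: "y \<in> K \<longleftrightarrow> (\<exists>r\<in>carrier R. \<exists>x\<in>L. y = r \<otimes> u \<oplus> x)" for y
    by (auto simp: K_def)
  have LK: "L \<subseteq> K"
  proof
    fix x assume "x \<in> L"
    then show "x \<in> K"
      unfolding K using L(1) assms(2) by (intro bexI[of _ \<zero>] bexI[of _ x]) auto
  qed
  have uK: "u \<in> K"
    unfolding K using L(2) assms(2) by (intro bexI[of _ \<one>] bexI[of _ \<zero>]) auto
  have "left_ideal K R"
  proof (rule left_idealI)
    show "K \<subseteq> carrier R"
      using subsetD[OF L(1)] assms(2) by (auto simp: K)
    show "\<zero> \<in> K"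
      using L(2) LK by blast
  next
    fix x y assume "x \<in> K" "y \<in> K"
    then obtain r a s b where rs: "r \<in> carrier R" "a \<in> L" "s \<in> carrier R" "b \<in> L"
      and xy: "x = r \<otimes> u \<oplus> a" "y = s \<otimes> u \<oplus> b"
      unfolding K by blast
    then have "a \<in> carrier R" "b \<in> carrier R"
      using L(1) by auto
    then have "x \<oplus> y = (r \<oplus> s) \<otimes> u \<oplus> (a \<oplus> b)"
      using rs assms(2) by (simp add: xy l_distr a_ac)
    then show "x \<oplus> y \<in> K"
      unfolding K using rs L(3) by blast
  next
    fix s x assume s: "s \<in> carrier R" and "x \<in> K"
    then obtain r a where r: "r \<in> carrier R" "a \<in> L" and x: "x = r \<otimes> u \<oplus> a"
      unfolding K by blast
    then have "s \<otimes> x = (s \<otimes> r) \<otimes> u \<oplus> s \<otimes> a"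
      using s assms(2) L(1) by (auto simp: x r_distr m_assoc)
    then show "s \<otimes> x \<in> K"
      unfolding K using r s L(5) by blast
  qed
  with LK uK show "left_ideal {r \<otimes> u \<oplus> x | r x. r \<in> carrier R \<and> x \<in> L} R"
    and "L \<subseteq> {r \<otimes> u \<oplus> x | r x. r \<in> carrier R \<and> x \<in> L}"
    and "u \<in> {r \<otimes> u \<oplus> x | r x. r \<in> carrier R \<and> x \<in> L}"
    by (simp_all only: K_def)
qed

text \<open>Zorn's lemma for the left ideals above \<open>K\<close> that avoid
  \<open>\<one>\<close>; properness in this form passes to unions of chains.\<close>

lemma maximal_left_ideal_exists:
  assumes "left_ideal K R" and "\<one> \<notin> K"
  obtains L where "maximal_left_ideal L R" and "K \<subseteq> L"
proof -
  let ?S = "{L. left_ideal L R \<and> \<one> \<notin> L \<and> K \<subseteq> L}"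
  have "\<exists>L\<in>?S. \<forall>J\<in>?S. L \<subseteq> J \<longrightarrow> J = L"
  proof (rule subset_Zorn_nonempty)
    show "?S \<noteq> {}"
      using assms by auto
  next
    fix C assume "C \<noteq> {}" and C: "subset.chain ?S C"
    then have mem: "J \<in> ?S" if "J \<in> C" for J
      using that by (auto simp: subset.chain_def)
    obtain J where J: "J \<in> C"
      using \<open>C \<noteq> {}\<close> by blast
    have "left_ideal (\<Union>C) R"
    proof (rule left_idealI)
      show "\<Union>C \<subseteq> carrier R"
        using mem left_idealD(1) by blast
      show "\<zero> \<in> \<Union>C"
        using mem J left_idealD(2) by blast
    next
      fix x y assume "x \<in> \<Union>C" "y \<in> \<Union>C"
      then obtain J1 J2 where J12: "J1 \<in> C" "x \<in> J1" "J2 \<in> C" "y \<in> J2"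
        by blast
      have "J1 \<subseteq> J2 \<or> J2 \<subseteq> J1"
        using C J12 by (auto simp: subset.chain_def)
      then obtain J3 where "J3 \<in> C" "x \<in> J3" "y \<in> J3"
        using J12 by blast
      then show "x \<oplus> y \<in> \<Union>C"
        using mem left_idealD(3) by blast
    next
      fix r x assume "r \<in> carrier R" "x \<in> \<Union>C"
      then show "r \<otimes> x \<in> \<Union>C"
        using mem left_idealD(5) by blast
    qed
    then show "\<Union>C \<in> ?S"
      using mem J by blast
  qed
  then obtain L where L: "L \<in> ?S" and max: "\<forall>J\<in>?S. L \<subseteq> J \<longrightarrow> J = L"
    by (elim bexE)
  have "maximal_left_ideal L R"
    unfolding maximal_left_ideal_def
  proof (intro conjI allI impI)
    show "left_ideal L R" "L \<noteq> carrier R"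
      using L by auto
    fix J assume "left_ideal J R \<and> L \<subseteq> J"
    then show "J = L \<or> J = carrier R"
      using L bspec[OF max, of J] left_ideal_eq_carrier_iff[of J] by auto
  qed
  then show thesis
    using that L by blast
qed

end

text \<open>A coset has no preferred representative, so the action takes the union over all of them;
  for a left ideal \<open>L\<close> these cosets coincide. The elements are sets of scalars, the
  type over which the integrality hypothesis quantifies.\<close>

definition quotient_module :: "('r, 'k) ring_scheme \<Rightarrow> 'r set \<Rightarrow> ('r, 'r set) module" where
  "quotient_module R L =
     \<lparr>carrier = a_rcosets\<^bsub>R\<^esub> L, mult = undefined, one = undefined, zero = L,
      add = set_add R, smult = (\<lambda>r C. \<Union>x\<in>C. L +>\<^bsub>R\<^esub> (r \<otimes>\<^bsub>R\<^esub> x))\<rparr>"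

context ring
begin

lemma quotient_module_simps:
  assumes "left_ideal L R"
  shows "carrier (quotient_module R L) = (\<lambda>x. L +> x) ` carrier R"
    and "\<zero>\<^bsub>quotient_module R L\<^esub> = L"
    and "\<And>x y. \<lbrakk>x \<in> carrier R; y \<in> carrier R\<rbrakk> \<Longrightarrow>
           (L +> x) \<oplus>\<^bsub>quotient_module R L\<^esub> (L +> y) = L +> (x \<oplus> y)"
    and "\<And>r x. \<lbrakk>r \<in> carrier R; x \<in> carrier R\<rbrakk> \<Longrightarrow>
           r \<odot>\<^bsub>quotient_module R L\<^esub> (L +> x) = L +> (r \<otimes> x)"
    and "\<And>x. x \<in> carrier R \<Longrightarrow> L +> x = L \<longleftrightarrow> x \<in> L"
proof -
  interpret abelian_subgroup L R
    using assms by (intro abelian_subgroupI3 is_abelian_group) (simp add: left_ideal_def)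
  note L = left_idealD[OF assms]
  show "carrier (quotient_module R L) = (\<lambda>x. L +> x) ` carrier R"
    by (auto simp: quotient_module_def A_RCOSETS_def')
  show "\<zero>\<^bsub>quotient_module R L\<^esub> = L"
    by (simp add: quotient_module_def)
  show "(L +> x) \<oplus>\<^bsub>quotient_module R L\<^esub> (L +> y) = L +> (x \<oplus> y)"
    if "x \<in> carrier R" "y \<in> carrier R" for x y
    using that by (simp add: quotient_module_def a_rcos_sum)
  show "L +> x = L \<longleftrightarrow> x \<in> L" if "x \<in> carrier R" for x
    using that a_rcos_self[of x] a_rcos_const[of x] by auto
  show "r \<odot>\<^bsub>quotient_module R L\<^esub> (L +> x) = L +> (r \<otimes> x)"
    if r: "r \<in> carrier R" and x: "x \<in> carrier R" for r x
  proof -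
    \<comment> \<open>Independence of the representative: changing \<open>x\<close> by an element of
      \<open>L\<close> changes \<open>r \<otimes> x\<close> by an element of \<open>L\<close>, by
      left absorption.\<close>
    have "L +> (r \<otimes> y) = L +> (r \<otimes> x)" if y: "y \<in> L +> x" for y
    proof -
      obtain l where l: "l \<in> L" "y = l \<oplus> x"
        using y by (auto simp: a_r_coset_def')
      then have "r \<otimes> y = r \<otimes> l \<oplus> r \<otimes> x"
        using r x L(1) by (auto simp: r_distr)
      then have "r \<otimes> y \<in> L +> (r \<otimes> x)"
        using r l L(5) by (auto simp: a_r_coset_def')
      then show ?thesis
        using r x by (intro a_repr_independence'[symmetric]) auto
    qed
    moreover have "L +> x \<noteq> {}"
      using a_rcos_self[OF x] by (metis empty_iff)
    ultimately have "(\<Union>y\<in>L +> x. L +> (r \<otimes> y)) = L +> (r \<otimes> x)"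
      by (intro SUP_eq_const)
    then show ?thesis
      by (simp only: quotient_module_def module.simps)
  qed
qed

lemma quotient_module_left_module:
  assumes "left_ideal L R"
  shows "left_module R (quotient_module R L)"
proof -
  let ?M = "quotient_module R L"
  note simps = quotient_module_simps[OF assms]
  \<comment> \<open>The zero of the quotient is written as a coset of \<open>\<zero>\<close>, so
    that the rules for representatives apply to it.\<close>
  have L: "L = L +> \<zero>"
    using simps(5)[of \<zero>] left_idealD(2)[OF assms] by simp
  have z: "\<zero>\<^bsub>?M\<^esub> = L +> \<zero>"
    using simps(2) L by simp
  have "abelian_group ?M"
  proof (rule abelian_groupI)
    fix x assume "x \<in> carrier ?M"
    then obtain u where "u \<in> carrier R" "x = L +> u"
      by (auto simp: simps)
    then show "\<exists>y\<in>carrier ?M. y \<oplus>\<^bsub>?M\<^esub> x = \<zero>\<^bsub>?M\<^esub>"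
      by (intro bexI[of _ "L +> (\<ominus> u)"]) (auto simp: simps(1,3) z l_neg)
  next
    show "\<zero>\<^bsub>?M\<^esub> \<in> carrier ?M"
      unfolding z simps(1) by blast
  next
    fix x assume "x \<in> carrier ?M"
    then show "\<zero>\<^bsub>?M\<^esub> \<oplus>\<^bsub>?M\<^esub> x = x"
      unfolding z simps(1) by (auto simp: simps(3))
  qed (auto simp: simps(1,3) a_ac)
  then show ?thesis
    by (intro left_module.intro left_module_axioms.intro ring_axioms)
      (auto simp: simps(1,3,4) l_distr r_distr m_assoc)
qed

text \<open>A submodule of the quotient pulls back to a left ideal between \<open>L\<close> and
  \<open>R\<close>, of which maximality leaves only the two ends.\<close>

lemma quotient_module_simple:
  assumes "maximal_left_ideal L R"
  shows "simple_left_module R (quotient_module R L)"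
proof -
  let ?M = "quotient_module R L"
  have L: "left_ideal L R" "L \<noteq> carrier R"
    and max: "\<And>K. \<lbrakk>left_ideal K R; L \<subseteq> K\<rbrakk> \<Longrightarrow> K = L \<or> K = carrier R"
    using assms by (auto simp: maximal_left_ideal_def)
  note simps = quotient_module_simps[OF L(1)]
  interpret M: left_module R ?M
    by (rule quotient_module_left_module[OF L(1)])
  have "\<one> \<notin> L"
    using L left_ideal_eq_carrier_iff by simp
  then have "L +> \<one> \<noteq> L"
    by (simp add: simps(5))
  then have "carrier ?M \<noteq> {\<zero>\<^bsub>?M\<^esub>}"
    by (auto simp: simps(1,2))
  moreover have "U = {\<zero>\<^bsub>?M\<^esub>} \<or> U = carrier ?M" if "submodule U R ?M" for U
  proof -
    interpret U: submodule U R ?M by fact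
    define K where "K = {x \<in> carrier R. L +> x \<in> U}"
    have zero: "L \<in> U"
      using U.one_closed by (simp add: simps(2))
    have "left_ideal K R"
    proof (rule left_idealI)
      show "\<zero> \<in> K"
        using zero simps(5)[of \<zero>] left_idealD(2)[OF L(1)] by (simp add: K_def)
      show "x \<oplus> y \<in> K" if "x \<in> K" "y \<in> K" for x y
        using that U.m_closed[of "L +> x" "L +> y"] by (simp add: K_def simps(3))
      show "r \<otimes> x \<in> K" if "r \<in> carrier R" "x \<in> K" for r x
        using that U.smult_closed[of r "L +> x"] by (simp add: K_def simps(4))
    qed (auto simp: K_def)
    moreover have "L \<subseteq> K"
    proof
      fix x assume "x \<in> L"
      then have "x \<in> carrier R" "L +> x = L"
        using left_idealD(1)[OF L(1)] simps(5) by auto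
      then show "x \<in> K"
        using zero by (simp add: K_def)
    qed
    ultimately have "K = L \<or> K = carrier R"
      by (rule max)
    moreover have "U \<subseteq> (\<lambda>x. L +> x) ` carrier R"
      using U.subset by (simp add: simps(1))
    then have "U = (\<lambda>x. L +> x) ` K"
      by (auto simp: K_def)
    moreover have "(\<lambda>x. L +> x) ` L = {L}"
      using left_idealD(1,2)[OF L(1)] simps(5) by (auto simp: image_iff)
    ultimately show ?thesis
      using simps(1,2) by auto
  qed
  ultimately show ?thesis
    using M.left_module_axioms by (auto simp: simple_left_module_def)
qed

text \<open>Here \<open>t\<close> represents an element of the Jacobson radical of \<open>R / I\<close>.\<close>

lemma one_plus_left_invertible_mod:
  assumes I: "ideal I R" and t: "t \<in> carrier R"
    and prim: "\<And>Q. \<lbrakk>primitive_ideal Q R; I \<subseteq> Q\<rbrakk> \<Longrightarrow> t \<in> Q"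
  obtains v y where "v \<in> carrier R" and "y \<in> I" and "v \<otimes> (\<one> \<oplus> t) \<oplus> y = \<one>"
proof -
  let ?u = "\<one> \<oplus> t"
  let ?K = "{r \<otimes> ?u \<oplus> x | r x. r \<in> carrier R \<and> x \<in> I}"
  have u: "?u \<in> carrier R"
    using t by simp
  note K = left_ideal_principal_add[OF left_ideal_idealI[OF I] u]
  \<comment> \<open>Otherwise \<open>?u\<close> lies in a maximal left ideal \<open>L\<close> above
    \<open>I\<close>. The annihilator of the simple module R/L is a primitive ideal above
    \<open>I\<close>, so \<open>t\<close> kills the class of \<open>\<one>\<close>. Then
    \<open>t\<close>, and with it \<open>\<one> = ?u \<ominus> t\<close>, lies in
    \<open>L\<close>.\<close>
  have "\<one> \<in> ?K"
  proof (rule ccontr)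
    assume "\<one> \<notin> ?K"
    then obtain L where max: "maximal_left_ideal L R" and KL: "?K \<subseteq> L"
      using maximal_left_ideal_exists[OF K(1)] by blast
    have L: "left_ideal L R" "L \<noteq> carrier R"
      using max by (auto simp: maximal_left_ideal_def)
    note simps = quotient_module_simps[OF L(1)]
    let ?Q = "annihilator R (quotient_module R L)"
    have "primitive_ideal ?Q R"
      by (rule primitive_ideal_annihilator[OF quotient_module_simple[OF max]])
    moreover have "I \<subseteq> ?Q"
    proof
      fix y assume y: "y \<in> I"
      then have "y \<in> carrier R"
        by (rule ideal.Icarr[OF I])
      \<comment> \<open>This uses that \<open>I\<close> is two-sided: right absorption keeps
        \<open>y \<otimes> x\<close> in \<open>I\<close>, hence in \<open>L\<close>.\<close>
      moreover have "y \<otimes> x \<in> L" if "x \<in> carrier R" for x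
        using ideal.I_r_closed[OF I y that] K(2) KL by auto
      ultimately show "y \<in> ?Q"
        by (auto simp: annihilator_def simps)
    qed
    ultimately have "t \<in> ?Q"
      by (rule prim)
    then have "L +> (t \<otimes> \<one>) = L"
      using t simps(4)[of t \<one>] by (auto simp: annihilator_def simps(1,2))
    then have "t \<in> L"
      using t simps(5) by simp
    moreover have "?u \<in> L"
      using K(3) KL by blast
    ultimately have "?u \<ominus> t \<in> L"
      using left_idealD(4)[OF L(1)] by blast
    moreover have "?u \<ominus> t = \<one>"
      using t by (simp add: a_minus_def a_assoc r_neg)
    ultimately show False
      using L left_ideal_eq_carrier_iff by simp
  qed
  then obtain v y where "v \<in> carrier R" "y \<in> I" "\<one> = v \<otimes> ?u \<oplus> y"
    by blast
  then show thesis
    using that by simp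
qed

end

section \<open>Nil ideals modulo a prime ideal\<close>

context ring
begin

text \<open>Let \<open>T\<close> be the right annihilator of \<open>xR\<close> modulo
  \<open>P\<close> and \<open>S\<close> the left annihilator of \<open>T\<close>. Both are two-sided
  and their product lies in \<open>P\<close>. Moreover \<open>x\<close> is in \<open>T\<close> by
  assumption and in \<open>S\<close> by taking \<open>b = \<one>\<close>, so whichever of the two
  lies in \<open>P\<close> puts \<open>x\<close> there.\<close>

lemma prime_idealD:
  assumes P: "prime_ideal P R" and x: "x \<in> carrier R"
    and xbx: "\<And>b. b \<in> carrier R \<Longrightarrow> x \<otimes> b \<otimes> x \<in> P"
  shows "x \<in> P"
proof -
  interpret P: ideal P R
    using P by (simp add: prime_ideal_def)
  define T where "T = {y \<in> carrier R. \<forall>b\<in>carrier R. x \<otimes> b \<otimes> y \<in> P}"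
  define S where "S = {z \<in> carrier R. \<forall>y\<in>T. z \<otimes> y \<in> P}"
  have idealI': "ideal J R"
    if sub: "J \<subseteq> carrier R" and zero: "\<zero> \<in> J" and add: "\<And>x y. \<lbrakk>x \<in> J; y \<in> J\<rbrakk> \<Longrightarrow> x \<oplus> y \<in> J"
      and l: "\<And>r x. \<lbrakk>r \<in> carrier R; x \<in> J\<rbrakk> \<Longrightarrow> r \<otimes> x \<in> J"
      and r: "\<And>r x. \<lbrakk>r \<in> carrier R; x \<in> J\<rbrakk> \<Longrightarrow> x \<otimes> r \<in> J" for J
    using left_idealI[OF sub zero add l] l r
    by (intro idealI ring_axioms) (auto simp: left_ideal_def additive_subgroup_def)
  have "ideal T R"
  proof (rule idealI')
    show "r \<otimes> y \<in> T" if "r \<in> carrier R" "y \<in> T" for r y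
    proof -
      have "x \<otimes> b \<otimes> (r \<otimes> y) = x \<otimes> (b \<otimes> r) \<otimes> y" if "b \<in> carrier R" for b
        using that x \<open>r \<in> carrier R\<close> \<open>y \<in> T\<close> by (simp add: m_assoc T_def)
      then show ?thesis
        using that by (auto simp: T_def)
    qed
    show "y \<otimes> r \<in> T" if "r \<in> carrier R" "y \<in> T" for r y
    proof -
      have "x \<otimes> b \<otimes> (y \<otimes> r) = x \<otimes> b \<otimes> y \<otimes> r" if "b \<in> carrier R" for b
        using that x \<open>r \<in> carrier R\<close> \<open>y \<in> T\<close> by (simp add: m_assoc T_def)
      then show ?thesis
        using that P.I_r_closed by (auto simp: T_def)
    qed
  qed (use x in \<open>auto simp: T_def r_distr\<close>)
  moreover have "ideal S R"
  proof (rule idealI')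
    show "r \<otimes> z \<in> S" if "r \<in> carrier R" "z \<in> S" for r z
      using that P.I_l_closed by (auto simp: S_def T_def m_assoc)
    show "z \<otimes> r \<in> S" if "r \<in> carrier R" "z \<in> S" for r z
      using that ideal.I_l_closed[OF \<open>ideal T R\<close>] by (auto simp: S_def T_def m_assoc)
    show "\<zero> \<in> S" 
      by (auto simp: S_def T_def)
    show "y \<oplus> z \<in> S" if "y \<in> S" "z \<in> S" for y z
      using that by (auto simp: S_def T_def l_distr)
  qed (auto simp: S_def)
  moreover have "S \<cdot> T \<subseteq> P"
  proof
    fix z assume "z \<in> S \<cdot> T"
    then show "z \<in> P"
      by induction (auto simp: S_def)
  qed
  moreover have "x \<in> T"
    using x xbx by (simp add: T_def)
  moreover have "x \<in> S"
    using x by (auto simp: S_def T_def dest: bspec[of _ _ \<one>])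
  ultimately show ?thesis
    using P unfolding prime_ideal_def by blast
qed

text \<open>If no member were maximal, a choice function \<open>g\<close> would move each member to
  a strictly larger one, and iterating \<open>g\<close> would give a strictly ascending
  chain.\<close>

lemma left_noetherian_maximal:
  assumes noeth: "left_noetherian R" and "S \<noteq> {}" and left: "\<And>I. I \<in> S \<Longrightarrow> left_ideal I R"
  obtains I where "I \<in> S" and "\<And>J. \<lbrakk>J \<in> S; I \<subseteq> J\<rbrakk> \<Longrightarrow> J = I"
proof (rule ccontr)
  assume "\<not> thesis"
  then have step: "\<forall>I\<in>S. \<exists>J\<in>S. I \<subset> J"
    using that by blast
  then obtain g where g: "\<And>I. I \<in> S \<Longrightarrow> g I \<in> S \<and> I \<subset> g I"
    by metis
  obtain I0 where "I0 \<in> S"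
    using \<open>S \<noteq> {}\<close> by blast
  define I where "I n = (g ^^ n) I0" for n
  have mem: "I n \<in> S" for n
    by (induction n) (use \<open>I0 \<in> S\<close> g in \<open>auto simp: I_def\<close>)
  have less: "I n \<subset> I (Suc n)" for n
    using g[OF mem[of n]] by (simp add: I_def)
  obtain N where "\<forall>n\<ge>N. I n = I N"
    using noeth mem less left unfolding left_noetherian_def by (metis psubset_imp_subset)
  then show False
    using less[of N] by (metis le_SucI order_refl psubset_eq)
qed

text \<open>Utumi's proof of Levitzki's theorem: take \<open>x \<in> N - P\<close> whose left annihilator modulo \<open>P\<close> is
  maximal. If \<open>y = x(bx)\<^sup>j\<close> is the last power product outside \<open>P\<close>, then \<open>y\<close> has the same left
  annihilator as \<open>x\<close>, and \<open>xb\<close> lies in it.\<close>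

lemma nil_ideal_subset_prime:
  assumes noeth: "left_noetherian R" and P: "prime_ideal P R" and N: "ideal N R"
    and nil: "\<And>x. x \<in> N \<Longrightarrow> \<exists>n. x [^] (n::nat) \<in> P"
  shows "N \<subseteq> P"
proof (rule ccontr)
  assume "\<not> N \<subseteq> P"
  interpret P: ideal P R
    using P by (simp add: prime_ideal_def)
  interpret N: ideal N R by fact
  define ann where "ann x = {b \<in> carrier R. b \<otimes> x \<in> P}" for x
  have "left_ideal (ann x) R" if "x \<in> carrier R" for x
    using that by (intro left_idealI) (auto simp: ann_def l_distr m_assoc P.I_l_closed)
  then have "\<And>I. I \<in> ann ` (N - P) \<Longrightarrow> left_ideal I R"
    using N.Icarr by auto
  moreover have "ann ` (N - P) \<noteq> {}"
    using \<open>\<not> N \<subseteq> P\<close> by auto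
  ultimately obtain I where I: "I \<in> ann ` (N - P)"
    and I_max: "\<And>J. \<lbrakk>J \<in> ann ` (N - P); I \<subseteq> J\<rbrakk> \<Longrightarrow> J = I"
    using left_noetherian_maximal[OF noeth, of "ann ` (N - P)"] by blast
  then obtain x where x: "x \<in> N" "x \<notin> P" and "I = ann x"
    by auto
  with I_max have max: "ann y = ann x" if "y \<in> N" "y \<notin> P" "ann x \<subseteq> ann y" for y
    using that by blast
  have xc: "x \<in> carrier R"
    using x N.Icarr by blast
  have "x \<otimes> b \<otimes> x \<in> P" if b: "b \<in> carrier R" for b
  proof -
    have xb: "x \<otimes> b \<in> carrier R"
      using xc b by simp
    \<comment> \<open>The same element as x(bx)^j. This form yields the recursion
      \<open>y_Suc\<close>, while \<open>y_right\<close> exhibits the factor \<open>x\<close> in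
      front, which gives \<open>ann x \<subseteq> ann (y j)\<close>.\<close>
    define y where "y j = (x \<otimes> b) [^] j \<otimes> x" for j :: nat
    have y: "y j \<in> N" for j
      using x xb by (simp add: y_def N.I_l_closed)
    have y_Suc: "y (Suc j) = x \<otimes> b \<otimes> y j" for j
      using xb xc nat_pow_Suc2[of "x \<otimes> b" j] by (simp add: y_def m_assoc del: nat_pow_Suc)
    have y_right: "\<exists>c\<in>carrier R. y j = x \<otimes> c" for j
    proof (cases j)
      case 0
      then show ?thesis
        using xc by (auto simp: y_def intro!: bexI[of _ \<one>])
    next
      case (Suc i)
      then show ?thesis
        using xc b y[of i] N.Icarr y_Suc[of i] by (auto simp: m_assoc intro!: bexI[of _ "b \<otimes> y i"])
    qed
    \<comment> \<open>Right absorption puts \<open>x \<otimes> b\<close> into \<open>N\<close>, so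
      it is nilpotent modulo \<open>P\<close>; the sequence \<open>y\<close> starts at
      \<open>x\<close> outside \<open>P\<close> and must enter \<open>P\<close> at some
      step.\<close>
    obtain n where "(x \<otimes> b) [^] (n::nat) \<in> P"
      using nil[of "x \<otimes> b"] x b N.I_r_closed by blast
    then have "y n \<in> P"
      using xc by (simp add: y_def P.I_r_closed)
    moreover have "y 0 \<notin> P"
      using x xc by (simp add: y_def)
    ultimately obtain j where j: "y j \<notin> P" "y (Suc j) \<in> P"
      by (induction n) auto
    have "ann x \<subseteq> ann (y j)"
    proof
      fix a assume a: "a \<in> ann x"
      obtain c where "c \<in> carrier R" "y j = x \<otimes> c"
        using y_right by blast
      then have "a \<otimes> y j = a \<otimes> x \<otimes> c"
        using a xc by (simp add: ann_def m_assoc)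
      then show "a \<in> ann (y j)"
        using a \<open>c \<in> carrier R\<close> P.I_r_closed by (simp add: ann_def)
    qed
    then have "ann (y j) = ann x"
      using y j by (intro max) auto
    moreover have "x \<otimes> b \<in> ann (y j)"
      using xb j y_Suc by (simp add: ann_def)
    ultimately show ?thesis
      by (simp add: ann_def)
  qed
  then have "x \<in> P"
    using prime_idealD[OF P xc] by blast
  with x show False
    by simp
qed

end

section \<open>Polynomials over a noncommutative ring\<close>

context UP_ring
begin

text \<open>Only the index \<open>n - k\<close> survives in the convolution. The factor
  \<open>a\<close> stays on the right, since \<open>R\<close> need not be commutative.\<close>

lemma coeff_mult_monom:
  assumes p: "p \<in> carrier P" and a: "a \<in> carrier R"
  shows "coeff P (p \<otimes>\<^bsub>P\<^esub> monom P a k) n = (if k \<le> n then coeff P p (n - k) \<otimes> a else \<zero>)"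
proof -
  have "coeff P (p \<otimes>\<^bsub>P\<^esub> monom P a k) n =
      (\<Oplus>i\<in>{..n}. coeff P p i \<otimes> (if k = n - i then a else \<zero>))"
    using p a by simp
  also have "\<dots> = (if k \<le> n then coeff P p (n - k) \<otimes> a else \<zero>)"
  proof (cases "k \<le> n")
    case True
    then have "(\<Oplus>i\<in>{..n}. coeff P p i \<otimes> (if k = n - i then a else \<zero>)) =
        (\<Oplus>i\<in>{..n}. if n - k = i then coeff P p i \<otimes> a else \<zero>)"
      using p a by (intro R.finsum_cong') auto
    also have "\<dots> = coeff P p (n - k) \<otimes> a"
      using p a by (intro R.finsum_singleton) auto
    finally show ?thesis
      using True by simp
  next
    case False
    then have "(\<Oplus>i\<in>{..n}. coeff P p i \<otimes> (if k = n - i then a else \<zero>)) = (\<Oplus>i\<in>{..n}. \<zero>)"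
      using p a by (intro R.finsum_cong') auto
    then show ?thesis
      using False by simp
  qed
  finally show ?thesis .
qed

text \<open>Needed for the values of \<open>\<sigma>\<close>: central in \<open>B\<close>, they must
  remain central as constants of \<open>P\<close> in order to scale endomorphisms of a
  \<open>P\<close>-module. The two products multiply every coefficient of \<open>p\<close> by
  \<open>a\<close>, one from each side.\<close>

lemma monom_0_commutes:
  assumes a: "a \<in> carrier R" and comm: "\<And>b. b \<in> carrier R \<Longrightarrow> a \<otimes> b = b \<otimes> a"
    and p: "p \<in> carrier P"
  shows "monom P a 0 \<otimes>\<^bsub>P\<^esub> p = p \<otimes>\<^bsub>P\<^esub> monom P a 0"
proof (rule up_eqI)
  show "coeff P (monom P a 0 \<otimes>\<^bsub>P\<^esub> p) n = coeff P (p \<otimes>\<^bsub>P\<^esub> monom P a 0) n" for n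
    unfolding monom_mult_is_smult[OF a p] coeff_mult_monom[OF p a]
    using a p comm by simp
qed (use a p in auto)

text \<open>This is I[X]. A coefficient of a product is a finite sum of products whose right factors
  lie in \<open>I\<close>.\<close>

lemma left_ideal_coeffs:
  assumes I: "ideal I R"
  shows "left_ideal {p \<in> carrier P. \<forall>n. coeff P p n \<in> I} P"
proof -
  interpret I: ideal I R by fact
  have sum: "(\<Oplus>i\<in>{..n}. f i) \<in> I" if "\<And>i. f i \<in> I" for f and n :: nat
  proof (induction n)
    case 0
    then show ?case
      using that I.Icarr by (simp add: Pi_def)
  next
    case (Suc n)
    then show ?case
      using that I.Icarr by (simp add: Pi_def)
  qed
  show ?thesis
  proof (rule P.left_idealI)
    fix p q assume p: "p \<in> carrier P" and q: "q \<in> {p \<in> carrier P. \<forall>n. coeff P p n \<in> I}"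
    then have "coeff P p i \<otimes> coeff P q j \<in> I" for i j
      by (simp add: I.I_l_closed)
    then show "p \<otimes>\<^bsub>P\<^esub> q \<in> {p \<in> carrier P. \<forall>n. coeff P p n \<in> I}"
      using p q by (simp add: sum)
  qed auto
qed

text \<open>The inverse of \<open>1 - sX\<close> could only be the geometric series in \<open>sX\<close>, which is not a
  polynomial modulo \<open>I\<close>.\<close>

lemma one_minus_sX_proper:
  assumes I: "ideal I R" and s: "s \<in> carrier R" and not_nil: "\<And>n::nat. s [^] n \<notin> I"
    and f: "f \<in> carrier P" and q: "q \<in> carrier P" "\<And>n. coeff P q n \<in> I"
  shows "f \<otimes>\<^bsub>P\<^esub> (\<one>\<^bsub>P\<^esub> \<ominus>\<^bsub>P\<^esub> monom P s 1) \<oplus>\<^bsub>P\<^esub> q \<noteq> \<one>\<^bsub>P\<^esub>"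
proof
  assume eq: "f \<otimes>\<^bsub>P\<^esub> (\<one>\<^bsub>P\<^esub> \<ominus>\<^bsub>P\<^esub> monom P s 1) \<oplus>\<^bsub>P\<^esub> q = \<one>\<^bsub>P\<^esub>"
  interpret I: ideal I R by fact
  let ?c = "coeff P f"
  have c: "?c n \<in> carrier R" for n
    using f by simp
  have "f \<otimes>\<^bsub>P\<^esub> (\<one>\<^bsub>P\<^esub> \<ominus>\<^bsub>P\<^esub> monom P s 1) = f \<ominus>\<^bsub>P\<^esub> f \<otimes>\<^bsub>P\<^esub> monom P s 1"
    using f s by (simp add: P.r_distr P.r_minus a_minus_def)
  \<comment> \<open>The equation is brought to the form 1 + f sX = f + q, free of subtraction,
    before coefficients are compared.\<close>
  then have "\<one>\<^bsub>P\<^esub> \<oplus>\<^bsub>P\<^esub> f \<otimes>\<^bsub>P\<^esub> monom P s 1 =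
      (f \<ominus>\<^bsub>P\<^esub> f \<otimes>\<^bsub>P\<^esub> monom P s 1 \<oplus>\<^bsub>P\<^esub> q) \<oplus>\<^bsub>P\<^esub> f \<otimes>\<^bsub>P\<^esub> monom P s 1"
    using eq by simp
  also have "\<dots> = (f \<oplus>\<^bsub>P\<^esub> q) \<oplus>\<^bsub>P\<^esub> (f \<otimes>\<^bsub>P\<^esub> monom P s 1 \<ominus>\<^bsub>P\<^esub> f \<otimes>\<^bsub>P\<^esub> monom P s 1)"
    using f s q(1) by (simp add: a_minus_def P.a_ac)
  also have "\<dots> = f \<oplus>\<^bsub>P\<^esub> q"
    using f s q(1) by (simp add: a_minus_def P.r_neg)
  finally have "coeff P (\<one>\<^bsub>P\<^esub> \<oplus>\<^bsub>P\<^esub> f \<otimes>\<^bsub>P\<^esub> monom P s 1) n = coeff P (f \<oplus>\<^bsub>P\<^esub> q) n" for n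
    by simp
  then have "(if n = 0 then \<one> else \<zero>) \<oplus> coeff P (f \<otimes>\<^bsub>P\<^esub> monom P s 1) n = ?c n \<oplus> coeff P q n" for n
    unfolding coeff_add[OF f q(1), symmetric] coeff_one[symmetric]
    using f s by (subst coeff_add[symmetric]) (simp_all del: coeff_add coeff_one coeff_mult)
  \<comment> \<open>Modulo \<open>I\<close> this is the recursion of the geometric series:
    \<open>?c 0\<close> is \<open>\<one>\<close>, and each later coefficient is the preceding one
    times \<open>s\<close>.\<close>
  then have rec: "(if n = 0 then \<one> else \<zero>) \<oplus> (if 1 \<le> n then ?c (n - 1) \<otimes> s else \<zero>)
      = ?c n \<oplus> coeff P q n" for n
    unfolding coeff_mult_monom[OF f s] .
  have diff: "?c n \<ominus> s [^] n \<in> I" for n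
  proof (induction n)
    case 0
    have "?c 0 \<ominus> \<one> = \<ominus> coeff P q 0"
      using rec[of 0] c[of 0] q(1)
      by (simp add: a_minus_def R.minus_add R.a_assoc[symmetric] R.r_neg)
    then show ?case
      using q(2) by simp
  next
    case (Suc n)
    have "?c n \<otimes> s = ?c (Suc n) \<oplus> coeff P q (Suc n)"
      using rec[of "Suc n"] c s by simp
    then have "?c (Suc n) = ?c n \<otimes> s \<ominus> coeff P q (Suc n)"
      using c[of "Suc n"] q(1) by (simp add: a_minus_def R.a_assoc R.r_neg)
    then have "?c (Suc n) \<ominus> s [^] Suc n = (?c n \<ominus> s [^] n) \<otimes> s \<ominus> coeff P q (Suc n)"
      using c s q(1) by (simp add: a_minus_def R.l_distr R.l_minus R.a_ac)
    then show ?case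
      using Suc I.I_r_closed s q(2) by (simp add: a_minus_def)
  qed
  \<comment> \<open>The coefficients vanish strictly above \<open>N\<close>, hence the index
    \<open>Suc N\<close>: there \<open>diff\<close> leaves only a power of \<open>s\<close>, up to
    sign.\<close>
  obtain N where "bound \<zero> N (coeff P f)"
    using f by (auto simp: UP_def P_def)
  then have "?c (Suc N) = \<zero>"
    by (simp add: bound_def)
  then have "\<ominus> (s [^] Suc N) \<in> I"
    using diff[of "Suc N"] s by (simp add: a_minus_def)
  then have "\<ominus> (\<ominus> (s [^] Suc N)) \<in> I"
    by (rule I.a_inv_closed)
  then have "s [^] Suc N \<in> I"
    using s by (simp del: nat_pow_Suc)
  then show False
    using not_nil by blast
qed

end

section \<open>Integrality of \<open>X\<close> on simple modules\<close>

lemma (in left_module) lsmult_zero_r: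
  assumes "r \<in> carrier R"
  shows "r \<odot>\<^bsub>M\<^esub> \<zero>\<^bsub>M\<^esub> = \<zero>\<^bsub>M\<^esub>"
  using lsmult_r_distr[of r "\<zero>\<^bsub>M\<^esub>" "\<zero>\<^bsub>M\<^esub>"] lsmult_closed[of r "\<zero>\<^bsub>M\<^esub>"] assms by simp

text \<open>Because \<open>\<sigma> z\<close> commutes with every \<open>r\<close>, the two actions
  on a value of \<open>f\<close> can be exchanged, which is the linearity of the multiple.\<close>

lemma (in left_module) End_algebra_smult_closed:
  assumes "\<sigma> z \<in> carrier R" and comm: "\<And>r. r \<in> carrier R \<Longrightarrow> \<sigma> z \<otimes>\<^bsub>R\<^esub> r = r \<otimes>\<^bsub>R\<^esub> \<sigma> z"
    and "f \<in> carrier (End_algebra R \<sigma> M)"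
  shows "z \<odot>\<^bsub>End_algebra R \<sigma> M\<^esub> f \<in> carrier (End_algebra R \<sigma> M)"
  using assms
  by (auto simp: End_algebra_def left_module_hom_def lsmult_closed lsmult_r_distr Pi_iff
      lsmult_assoc[symmetric])

lemma UP_X_End_power:
  fixes B :: "('b, 'k) ring_scheme" and M :: "(nat \<Rightarrow> 'b, 'm, 'l) module_scheme"
  assumes "ring B" and "left_module (UP B) M" and x: "x \<in> carrier M"
  shows "((\<lambda>m\<in>carrier M. UP_X B \<odot>\<^bsub>M\<^esub> m) [^]\<^bsub>End_algebra (UP B) \<sigma> M\<^esub> (j::nat)) x =
    monom (UP B) \<one>\<^bsub>B\<^esub> j \<odot>\<^bsub>M\<^esub> x"
proof -
  interpret UP_ring B "UP B"
    using assms(1) by (simp add: UP_ring_def)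
  interpret M: left_module "UP B" M by fact
  show ?thesis
    using x
  \<comment> \<open>Powers grow by composition on the right, so the successor power at
    \<open>x\<close> is the \<open>j\<close>-th power at X x; hence the generalisation over
    \<open>x\<close>.\<close>
  proof (induction j arbitrary: x)
    case 0
    then show ?case
      by (simp add: End_algebra_def M.lsmult_one nat_pow_def)
  next
    case (Suc j)
    have "UP_X B \<odot>\<^bsub>M\<^esub> x \<in> carrier M"
      using Suc.prems by (simp add: UP_X_def M.lsmult_closed)
    then show ?case
      using Suc.prems Suc.IH[of "UP_X B \<odot>\<^bsub>M\<^esub> x"] monom_one_Suc[of j]
      by (simp add: nat_pow_def End_algebra_def compose_def UP_X_def M.lsmult_assoc)
  qed
qed

text \<open>The assumption \<open>prim\<close> says that \<open>s\<close> represents an element of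
  the Jacobson radical of B/I. Here \<open>I\<close> is any ideal; primality enters when nilpotence
  is turned into membership by \<open>nil_ideal_subset_prime\<close>.\<close>

lemma nilpotent_mod_of_integral:
  fixes A :: "('a, 'k) ring_scheme"
    and B :: "('b, 'l) ring_scheme"
    and \<sigma> :: "'a \<Rightarrow> 'b"
  assumes B: "ring B" and \<sigma>: "\<sigma> \<in> ring_hom A B"
    and central: "\<forall>a\<in>carrier A. \<forall>b\<in>carrier B. \<sigma> a \<otimes>\<^bsub>B\<^esub> b = b \<otimes>\<^bsub>B\<^esub> \<sigma> a"
    and integral: "\<And>M :: (nat \<Rightarrow> 'b, (nat \<Rightarrow> 'b) set) module.
           simple_left_module (UP B) M \<Longrightarrow>
           integral_over A (End_algebra (UP B) (\<lambda>z. UP_const B (\<sigma> z)) M)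
             (\<lambda>m\<in>carrier M. UP_X B \<odot>\<^bsub>M\<^esub> m)"
    and I: "ideal I B" and s: "s \<in> carrier B"
    and prim: "\<And>Q. \<lbrakk>primitive_ideal Q B; I \<subseteq> Q\<rbrakk> \<Longrightarrow> s \<in> Q"
  shows "\<exists>n::nat. s [^]\<^bsub>B\<^esub> n \<in> I"
proof (rule ccontr)
  assume "\<not> (\<exists>n::nat. s [^]\<^bsub>B\<^esub> n \<in> I)"
  then have not_nil: "\<And>n::nat. s [^]\<^bsub>B\<^esub> n \<notin> I"
    by blast

  \<comment> \<open>A simple module over B[X] with a nonzero vector fixed by sX\<close>
  define P where "P = UP B"
  interpret UP_ring B P
    by (simp add: UP_ring_def B) (simp add: P_def)
  \<comment> \<open>From here on \<open>P\<close> is the polynomial ring, \<open>?IX\<close> is I[X]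
    and \<open>?w\<close> is 1 - sX.\<close>
  let ?IX = "{p \<in> carrier P. \<forall>n. coeff P p n \<in> I}"
  let ?w = "\<one>\<^bsub>P\<^esub> \<ominus>\<^bsub>P\<^esub> monom P s 1"
  have w: "?w \<in> carrier P"
    using s by simp
  note K = P.left_ideal_principal_add[OF left_ideal_coeffs[OF I] w]
  have "\<one>\<^bsub>P\<^esub> \<notin> {f \<otimes>\<^bsub>P\<^esub> ?w \<oplus>\<^bsub>P\<^esub> q | f q. f \<in> carrier P \<and> q \<in> ?IX}"
  proof
    assume "\<one>\<^bsub>P\<^esub> \<in> {f \<otimes>\<^bsub>P\<^esub> ?w \<oplus>\<^bsub>P\<^esub> q | f q. f \<in> carrier P \<and> q \<in> ?IX}"
    then obtain f q where f: "f \<in> carrier P" and q: "q \<in> ?IX"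
      and eq: "\<one>\<^bsub>P\<^esub> = f \<otimes>\<^bsub>P\<^esub> ?w \<oplus>\<^bsub>P\<^esub> q"
      by blast
    have "f \<otimes>\<^bsub>P\<^esub> ?w \<oplus>\<^bsub>P\<^esub> q \<noteq> \<one>\<^bsub>P\<^esub>"
      using q by (intro one_minus_sX_proper[OF I s not_nil f]) auto
    with eq show False
      by simp
  qed
  then obtain L where max: "maximal_left_ideal L P"
    and KL: "{f \<otimes>\<^bsub>P\<^esub> ?w \<oplus>\<^bsub>P\<^esub> q | f q. f \<in> carrier P \<and> q \<in> ?IX} \<subseteq> L"
    using P.maximal_left_ideal_exists[OF K(1)] by blast
  have L: "left_ideal L P" "L \<noteq> carrier P"
    using max by (simp_all add: maximal_left_ideal_def)
  have IX_L: "?IX \<subseteq> L"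
    using K(2) KL by (rule subset_trans)
  have w_L: "?w \<in> L"
    using KL K(3) by (rule subsetD)
  define M where "M = quotient_module P L"
  \<comment> \<open>Elements of \<open>L\<close> kill this class, and properness of \<open>L\<close>
    makes it nonzero.\<close>
  define m where "m = L +>\<^bsub>P\<^esub> \<one>\<^bsub>P\<^esub>"
  note simps = P.quotient_module_simps[OF L(1), folded M_def]
  interpret M: left_module P M
    unfolding M_def by (rule P.quotient_module_left_module[OF L(1)])
  have m: "m \<in> carrier M"
    by (simp add: m_def simps(1))
  have act_m: "r \<odot>\<^bsub>M\<^esub> m = L +>\<^bsub>P\<^esub> r" if "r \<in> carrier P" for r
    using that simps(4)[of r "\<one>\<^bsub>P\<^esub>"] by (simp add: m_def)
  have kill: "r \<odot>\<^bsub>M\<^esub> m = \<zero>\<^bsub>M\<^esub>" if "r \<in> L" for r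
    using that P.left_idealD(1)[OF L(1)] act_m[of r] simps(2) simps(5)[of r] by auto
  have m_nonzero: "m \<noteq> \<zero>\<^bsub>M\<^esub>"
    using L P.left_ideal_eq_carrier_iff[OF L(1)] simps(2) simps(5)[of "\<one>\<^bsub>P\<^esub>"] by (simp add: m_def)

  have sX_m: "monom P s 1 \<odot>\<^bsub>M\<^esub> m = m"
  proof -
    have "monom P s 1 \<odot>\<^bsub>M\<^esub> m = monom P s 1 \<odot>\<^bsub>M\<^esub> m \<oplus>\<^bsub>M\<^esub> ?w \<odot>\<^bsub>M\<^esub> m"
      using kill[OF w_L] s m by (simp add: M.lsmult_closed)
    also have "\<dots> = (monom P s 1 \<oplus>\<^bsub>P\<^esub> ?w) \<odot>\<^bsub>M\<^esub> m"
      using s w m by (simp only: M.lsmult_l_distr monom_closed)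
    also have "monom P s 1 \<oplus>\<^bsub>P\<^esub> ?w = \<one>\<^bsub>P\<^esub>"
      using s P.r_neg2[of "monom P s 1" "\<one>\<^bsub>P\<^esub>"]
      by (simp add: a_minus_def P.a_comm[of "\<one>\<^bsub>P\<^esub>"])
    finally show ?thesis
      using m by (simp add: M.lsmult_one)
  qed
  \<comment> \<open>As X commutes with \<open>s\<close>, this monomial is the \<open>j\<close>-th
    power of sX.\<close>
  have sjXj_m: "monom P (s [^]\<^bsub>B\<^esub> j) j \<odot>\<^bsub>M\<^esub> m = m" for j
  proof (induction j)
    case 0
    then show ?case
      using m by (simp add: M.lsmult_one)
  next
    case (Suc j)
    have "monom P (s [^]\<^bsub>B\<^esub> Suc j) (Suc j) = monom P (s [^]\<^bsub>B\<^esub> j) j \<otimes>\<^bsub>P\<^esub> monom P s 1"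
      using monom_mult[of "s [^]\<^bsub>B\<^esub> j" s j 1] s by simp
    then show ?case
      using Suc sX_m s m by (simp add: M.lsmult_assoc)
  qed

  \<comment> \<open>The integral equation for X, multiplied by the n-th power of s\<close>
  define E where "E = End_algebra P (\<lambda>z. monom P (\<sigma> z) 0) M"
  define \<phi> where "\<phi> = (\<lambda>m\<in>carrier M. UP_X B \<odot>\<^bsub>M\<^esub> m)"
  interpret E: ring E
    unfolding E_def by (rule End_algebra_ring[OF M.left_module_axioms])
  have "simple_left_module (UP B) M"
    using P.quotient_module_simple[OF max] by (simp add: M_def P_def)
  from integral[OF this] obtain n z where n: "n \<ge> (1::nat)" and z: "z \<in> {..<n} \<rightarrow> carrier A"
    and eq: "\<phi> [^]\<^bsub>E\<^esub> n \<oplus>\<^bsub>E\<^esub> (\<Oplus>\<^bsub>E\<^esub>j\<in>{..<n}. z j \<odot>\<^bsub>E\<^esub> (\<phi> [^]\<^bsub>E\<^esub> j)) = \<zero>\<^bsub>E\<^esub>"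
    unfolding integral_over_def E_def \<phi>_def P_def UP_const_def by blast
  have \<phi>: "\<phi> \<in> carrier E"
    using UP_X_mult_endomorphism[OF B, of M] M.left_module_axioms
    unfolding E_def \<phi>_def P_def by blast
  have pow: "(\<phi> [^]\<^bsub>E\<^esub> j) m = monom P \<one>\<^bsub>B\<^esub> j \<odot>\<^bsub>M\<^esub> m" for j :: nat
    using UP_X_End_power[OF B _ m] M.left_module_axioms unfolding E_def \<phi>_def P_def by blast
  have \<sigma>z: "\<sigma> (z j) \<in> carrier B" if "j < n" for j
    using that z \<sigma> by (auto simp: ring_hom_def Pi_iff)
  \<comment> \<open>Centrality of \<open>\<sigma> (z j)\<close> makes each summand an endomorphism,
    as splitting the sum in \<open>E\<close> requires.\<close>
  have term_closed: "z j \<odot>\<^bsub>E\<^esub> (\<phi> [^]\<^bsub>E\<^esub> j) \<in> carrier E" if "j < n" for j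
    unfolding E_def
  proof (rule M.End_algebra_smult_closed)
    show "monom P (\<sigma> (z j)) 0 \<otimes>\<^bsub>P\<^esub> r = r \<otimes>\<^bsub>P\<^esub> monom P (\<sigma> (z j)) 0" if "r \<in> carrier P" for r
      using that \<open>j < n\<close> z \<sigma>z central by (intro monom_0_commutes) auto
    show "\<phi> [^]\<^bsub>End_algebra P (\<lambda>z. monom P (\<sigma> z) 0) M\<^esub> j
        \<in> carrier (End_algebra P (\<lambda>z. monom P (\<sigma> z) 0) M)"
      using E.nat_pow_closed[OF \<phi>] by (simp add: E_def)
  qed (use that \<sigma>z in simp)
  let ?sn = "monom P (s [^]\<^bsub>B\<^esub> n) 0"
  have sn: "?sn \<in> carrier P"
    using s by simp
  \<comment> \<open>With c for the central element \<open>\<sigma> (z j)\<close>, s^n c X^j m = c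
    s^(n-j) (s^j X^j m) = c s^(n-j) m.\<close>
  have summand: "\<exists>u\<in>carrier B. ?sn \<odot>\<^bsub>M\<^esub> ((z j \<odot>\<^bsub>E\<^esub> (\<phi> [^]\<^bsub>E\<^esub> j)) m) = monom P (u \<otimes>\<^bsub>B\<^esub> s) 0 \<odot>\<^bsub>M\<^esub> m"
    if "j < n" for j
  proof -
    \<comment> \<open>Since \<open>j < n\<close>, at least one of the \<open>n - j\<close> factors
      \<open>s\<close> remains; \<open>k\<close> counts the others, and the last one is kept on the
      right of \<open>?u\<close>.\<close>
    define k where "k = n - Suc j"
    have nk: "n = Suc k + j"
      using that by (simp add: k_def)
    let ?u = "\<sigma> (z j) \<otimes>\<^bsub>B\<^esub> s [^]\<^bsub>B\<^esub> k"
    have u: "?u \<in> carrier B"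
      using \<sigma>z[OF that] s by simp
    have val: "(z j \<odot>\<^bsub>E\<^esub> (\<phi> [^]\<^bsub>E\<^esub> j)) m =
        monom P (\<sigma> (z j)) 0 \<odot>\<^bsub>M\<^esub> (monom P \<one>\<^bsub>B\<^esub> j \<odot>\<^bsub>M\<^esub> m)"
      using m pow[of j] by (simp add: E_def End_algebra_def)
    have comm: "s [^]\<^bsub>B\<^esub> n \<otimes>\<^bsub>B\<^esub> \<sigma> (z j) = ?u \<otimes>\<^bsub>B\<^esub> s \<otimes>\<^bsub>B\<^esub> s [^]\<^bsub>B\<^esub> j"
    proof -
      have "s [^]\<^bsub>B\<^esub> n \<otimes>\<^bsub>B\<^esub> \<sigma> (z j) = \<sigma> (z j) \<otimes>\<^bsub>B\<^esub> s [^]\<^bsub>B\<^esub> n"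
        using central that z s by (auto simp: Pi_iff)
      also have "\<dots> = \<sigma> (z j) \<otimes>\<^bsub>B\<^esub> (s [^]\<^bsub>B\<^esub> k \<otimes>\<^bsub>B\<^esub> s \<otimes>\<^bsub>B\<^esub> s [^]\<^bsub>B\<^esub> j)"
        using R.nat_pow_mult[OF s, of "Suc k" j] by (simp add: nk)
      also have "\<dots> = ?u \<otimes>\<^bsub>B\<^esub> s \<otimes>\<^bsub>B\<^esub> s [^]\<^bsub>B\<^esub> j"
        using \<sigma>z[OF that] s by (simp add: R.m_assoc)
      finally show ?thesis .
    qed
    have "?sn \<otimes>\<^bsub>P\<^esub> (monom P (\<sigma> (z j)) 0 \<otimes>\<^bsub>P\<^esub> monom P \<one>\<^bsub>B\<^esub> j)
        = monom P (s [^]\<^bsub>B\<^esub> n \<otimes>\<^bsub>B\<^esub> \<sigma> (z j)) j"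
      using \<sigma>z[OF that] s monom_mult[of "\<sigma> (z j)" "\<one>\<^bsub>B\<^esub>" 0 j]
        monom_mult[of "s [^]\<^bsub>B\<^esub> n" "\<sigma> (z j)" 0 j] by simp
    also have "\<dots> = monom P (?u \<otimes>\<^bsub>B\<^esub> s) 0 \<otimes>\<^bsub>P\<^esub> monom P (s [^]\<^bsub>B\<^esub> j) j"
      using u s monom_mult[of "?u \<otimes>\<^bsub>B\<^esub> s" "s [^]\<^bsub>B\<^esub> j" 0 j] unfolding comm by simp
    finally have prod: "?sn \<otimes>\<^bsub>P\<^esub> (monom P (\<sigma> (z j)) 0 \<otimes>\<^bsub>P\<^esub> monom P \<one>\<^bsub>B\<^esub> j)
        = monom P (?u \<otimes>\<^bsub>B\<^esub> s) 0 \<otimes>\<^bsub>P\<^esub> monom P (s [^]\<^bsub>B\<^esub> j) j" .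
    have closed: "monom P (\<sigma> (z j)) 0 \<in> carrier P" "monom P \<one>\<^bsub>B\<^esub> j \<in> carrier P"
      "monom P (?u \<otimes>\<^bsub>B\<^esub> s) 0 \<in> carrier P" "monom P (s [^]\<^bsub>B\<^esub> j) j \<in> carrier P"
      using \<sigma>z[OF that] u s by (simp_all only: monom_closed R.m_closed R.nat_pow_closed R.one_closed)
    have "?sn \<odot>\<^bsub>M\<^esub> (monom P (\<sigma> (z j)) 0 \<odot>\<^bsub>M\<^esub> (monom P \<one>\<^bsub>B\<^esub> j \<odot>\<^bsub>M\<^esub> m))
        = (?sn \<otimes>\<^bsub>P\<^esub> (monom P (\<sigma> (z j)) 0 \<otimes>\<^bsub>P\<^esub> monom P \<one>\<^bsub>B\<^esub> j)) \<odot>\<^bsub>M\<^esub> m"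
      using closed sn m by (simp only: M.lsmult_assoc M.lsmult_closed P.m_closed)
    also have "\<dots> = monom P (?u \<otimes>\<^bsub>B\<^esub> s) 0 \<odot>\<^bsub>M\<^esub> m"
      unfolding prod using closed m by (simp only: M.lsmult_assoc sjXj_m)
    finally show ?thesis
      unfolding val using u by blast
  qed
  \<comment> \<open>The left ideal Bs is closed under addition, so the witnesses add up. Membership
    in \<open>E\<close> is carried along so that the partial sum has its value at \<open>m\<close>
    in \<open>M\<close>, where \<open>?sn\<close> distributes.\<close>
  have sum: "(\<Oplus>\<^bsub>E\<^esub>j\<in>{..<k}. z j \<odot>\<^bsub>E\<^esub> (\<phi> [^]\<^bsub>E\<^esub> j)) \<in> carrier E \<and>
      (\<exists>u\<in>carrier B. ?sn \<odot>\<^bsub>M\<^esub> ((\<Oplus>\<^bsub>E\<^esub>j\<in>{..<k}. z j \<odot>\<^bsub>E\<^esub> (\<phi> [^]\<^bsub>E\<^esub> j)) m)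
        = monom P (u \<otimes>\<^bsub>B\<^esub> s) 0 \<odot>\<^bsub>M\<^esub> m)" if "k \<le> n" for k
    using that
  proof (induction k)
    case 0
    have "?sn \<odot>\<^bsub>M\<^esub> (\<zero>\<^bsub>E\<^esub> m) = monom P (\<zero>\<^bsub>B\<^esub> \<otimes>\<^bsub>B\<^esub> s) 0 \<odot>\<^bsub>M\<^esub> m"
      using m s sn by (simp add: E_def End_algebra_def M.lsmult_zero_r M.lsmult_zero_l)
    then show ?case
      by (auto intro!: bexI[of _ "\<zero>\<^bsub>B\<^esub>"])
  next
    case (Suc k)
    let ?t = "z k \<odot>\<^bsub>E\<^esub> (\<phi> [^]\<^bsub>E\<^esub> k)" and ?S = "\<Oplus>\<^bsub>E\<^esub>j\<in>{..<k}. z j \<odot>\<^bsub>E\<^esub> (\<phi> [^]\<^bsub>E\<^esub> j)"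
    have t: "?t \<in> carrier E"
      using Suc.prems term_closed by simp
    obtain u where S: "?S \<in> carrier E" and u: "u \<in> carrier B"
      and Su: "?sn \<odot>\<^bsub>M\<^esub> (?S m) = monom P (u \<otimes>\<^bsub>B\<^esub> s) 0 \<odot>\<^bsub>M\<^esub> m"
      using Suc by auto
    obtain v where v: "v \<in> carrier B"
      and tv: "?sn \<odot>\<^bsub>M\<^esub> (?t m) = monom P (v \<otimes>\<^bsub>B\<^esub> s) 0 \<odot>\<^bsub>M\<^esub> m"
      using Suc.prems summand[of k] by auto
    have sum: "(\<Oplus>\<^bsub>E\<^esub>j\<in>{..<Suc k}. z j \<odot>\<^bsub>E\<^esub> (\<phi> [^]\<^bsub>E\<^esub> j)) = ?t \<oplus>\<^bsub>E\<^esub> ?S"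
      unfolding lessThan_Suc using Suc.prems term_closed by (intro E.finsum_insert) auto
    have app: "f m \<in> carrier M" if "f \<in> carrier E" for f
      using that m by (auto simp: E_def End_algebra_def left_module_hom_def)
    have "(?t \<oplus>\<^bsub>E\<^esub> ?S) m = ?t m \<oplus>\<^bsub>M\<^esub> ?S m"
      using m by (simp add: E_def End_algebra_def)
    then have "?sn \<odot>\<^bsub>M\<^esub> ((?t \<oplus>\<^bsub>E\<^esub> ?S) m)
        = monom P (v \<otimes>\<^bsub>B\<^esub> s) 0 \<odot>\<^bsub>M\<^esub> m \<oplus>\<^bsub>M\<^esub> monom P (u \<otimes>\<^bsub>B\<^esub> s) 0 \<odot>\<^bsub>M\<^esub> m"
      using M.lsmult_r_distr[OF sn app[OF t] app[OF S]] Su tv by simp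
    also have "\<dots> = monom P ((v \<oplus>\<^bsub>B\<^esub> u) \<otimes>\<^bsub>B\<^esub> s) 0 \<odot>\<^bsub>M\<^esub> m"
      using u v s m by (simp only: M.lsmult_l_distr monom_add monom_closed R.l_distr R.m_closed)
    finally show ?case
      unfolding sum using t S u v by (blast intro: E.add.m_closed R.add.m_closed)
  qed
  let ?S = "\<Oplus>\<^bsub>E\<^esub>j\<in>{..<n}. z j \<odot>\<^bsub>E\<^esub> (\<phi> [^]\<^bsub>E\<^esub> j)"
  obtain u where S: "?S \<in> carrier E" and u: "u \<in> carrier B"
    and Su: "?sn \<odot>\<^bsub>M\<^esub> (?S m) = monom P (u \<otimes>\<^bsub>B\<^esub> s) 0 \<odot>\<^bsub>M\<^esub> m"
    using sum[of n] by auto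
  define t where "t = u \<otimes>\<^bsub>B\<^esub> s"
  have t: "t \<in> carrier B"
    using u s by (simp add: t_def)
  have Sm: "?S m \<in> carrier M"
    using S m by (auto simp: E_def End_algebra_def left_module_hom_def)
  have "(\<phi> [^]\<^bsub>E\<^esub> n \<oplus>\<^bsub>E\<^esub> ?S) m = (\<phi> [^]\<^bsub>E\<^esub> n) m \<oplus>\<^bsub>M\<^esub> ?S m"
    using m by (simp add: E_def End_algebra_def)
  moreover have "\<zero>\<^bsub>E\<^esub> m = \<zero>\<^bsub>M\<^esub>"
    using m by (simp add: E_def End_algebra_def)
  ultimately have "monom P \<one>\<^bsub>B\<^esub> n \<odot>\<^bsub>M\<^esub> m \<oplus>\<^bsub>M\<^esub> ?S m = \<zero>\<^bsub>M\<^esub>"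
    using eq pow[of n] by simp
  \<comment> \<open>By \<open>sjXj_m\<close> the leading term becomes \<open>m\<close> itself, and
    by \<open>Su\<close> the remaining sum becomes \<open>t\<close> acting on
    \<open>m\<close>.\<close>
  then have "?sn \<odot>\<^bsub>M\<^esub> (monom P \<one>\<^bsub>B\<^esub> n \<odot>\<^bsub>M\<^esub> m) \<oplus>\<^bsub>M\<^esub> ?sn \<odot>\<^bsub>M\<^esub> (?S m) = \<zero>\<^bsub>M\<^esub>"
    using M.lsmult_r_distr[OF sn _ Sm, of "monom P \<one>\<^bsub>B\<^esub> n \<odot>\<^bsub>M\<^esub> m"] M.lsmult_zero_r[OF sn] m
    by (simp add: M.lsmult_closed)
  moreover have "?sn \<odot>\<^bsub>M\<^esub> (monom P \<one>\<^bsub>B\<^esub> n \<odot>\<^bsub>M\<^esub> m) = m"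
    using M.lsmult_assoc[OF sn _ m, of "monom P \<one>\<^bsub>B\<^esub> n"]
      monom_mult[of "s [^]\<^bsub>B\<^esub> n" "\<one>\<^bsub>B\<^esub>" 0 n] s sjXj_m[of n] by simp
  ultimately have "m \<oplus>\<^bsub>M\<^esub> monom P t 0 \<odot>\<^bsub>M\<^esub> m = \<zero>\<^bsub>M\<^esub>"
    by (simp add: Su t_def)
  then have zero: "monom P (\<one>\<^bsub>B\<^esub> \<oplus>\<^bsub>B\<^esub> t) 0 \<odot>\<^bsub>M\<^esub> m = \<zero>\<^bsub>M\<^esub>"
    using t m by (simp add: M.lsmult_l_distr M.lsmult_one)

  \<comment> \<open>Left invertibility of 1 + us modulo I\<close>
  have "t \<in> Q" if "primitive_ideal Q B" "I \<subseteq> Q" for Q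
    using prim[OF that] that(1) u unfolding t_def primitive_ideal_def
    by (blast intro: ideal.I_l_closed)
  then obtain v y where v: "v \<in> carrier B" and y: "y \<in> I"
    and inv: "v \<otimes>\<^bsub>B\<^esub> (\<one>\<^bsub>B\<^esub> \<oplus>\<^bsub>B\<^esub> t) \<oplus>\<^bsub>B\<^esub> y = \<one>\<^bsub>B\<^esub>"
    using R.one_plus_left_invertible_mod[OF I t] by blast
  \<comment> \<open>The coefficients of \<open>monom P y 0\<close> in positive degree are zero, so
    its membership in I[X] also uses \<open>I0\<close>; lying in \<open>L\<close>, it kills
    \<open>m\<close>.\<close>
  have yc: "y \<in> carrier B" and I0: "\<zero>\<^bsub>B\<^esub> \<in> I"
    using ideal.Icarr[OF I y] additive_subgroup.zero_closed[OF ideal.axioms(1)[OF I]] by auto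
  then have "monom P y 0 \<in> L"
    using IX_L y by auto
  have ut: "\<one>\<^bsub>B\<^esub> \<oplus>\<^bsub>B\<^esub> t \<in> carrier B"
    using t by simp
  have "m = monom P (v \<otimes>\<^bsub>B\<^esub> (\<one>\<^bsub>B\<^esub> \<oplus>\<^bsub>B\<^esub> t) \<oplus>\<^bsub>B\<^esub> y) 0 \<odot>\<^bsub>M\<^esub> m"
    unfolding inv using m by (simp add: M.lsmult_one)
  also have "\<dots> = (monom P v 0 \<otimes>\<^bsub>P\<^esub> monom P (\<one>\<^bsub>B\<^esub> \<oplus>\<^bsub>B\<^esub> t) 0 \<oplus>\<^bsub>P\<^esub> monom P y 0) \<odot>\<^bsub>M\<^esub> m"
    using v ut yc monom_mult[OF v ut, of 0 0] monom_add[of "v \<otimes>\<^bsub>B\<^esub> (\<one>\<^bsub>B\<^esub> \<oplus>\<^bsub>B\<^esub> t)" y 0]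
    by (simp del: monom_add monom_mult)
  also have "\<dots> = monom P v 0 \<odot>\<^bsub>M\<^esub> (monom P (\<one>\<^bsub>B\<^esub> \<oplus>\<^bsub>B\<^esub> t) 0 \<odot>\<^bsub>M\<^esub> m) \<oplus>\<^bsub>M\<^esub> monom P y 0 \<odot>\<^bsub>M\<^esub> m"
    using v ut yc m by (simp only: M.lsmult_l_distr M.lsmult_assoc monom_closed P.m_closed)
  also have "\<dots> = \<zero>\<^bsub>M\<^esub>"
    unfolding zero kill[OF \<open>monom P y 0 \<in> L\<close>] using v by (simp add: M.lsmult_zero_r)
  finally show False
    using m_nonzero by blast
qed

theorem theorem9:
  fixes A :: "('a, 'k) ring_scheme"
    and B :: "('b, 'l) ring_scheme"
    and \<sigma> :: "'a \<Rightarrow> 'b"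
  assumes "cring A" and "ring B" and "\<sigma> \<in> ring_hom A B"
    and "\<forall>a\<in>carrier A. \<forall>b\<in>carrier B. \<sigma> a \<otimes>\<^bsub>B\<^esub> b = b \<otimes>\<^bsub>B\<^esub> \<sigma> a"
    and "left_noetherian B"
    and "\<And>M :: (nat \<Rightarrow> 'b, (nat \<Rightarrow> 'b) set) module.
           simple_left_module (UP B) M \<Longrightarrow>
           integral_over A (End_algebra (UP B) (\<lambda>z. UP_const B (\<sigma> z)) M)
             (\<lambda>m\<in>carrier M. UP_X B \<odot>\<^bsub>M\<^esub> m)"
  shows "jacobson_ring B"
proof -
  interpret ring B by fact
  let ?prim = "\<lambda>I. {Q. primitive_ideal Q B \<and> I \<subseteq> Q}"
  have radical: "carrier B \<inter> \<Inter>(?prim P) \<subseteq> P" if P: "prime_ideal P B" for P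
  proof (rule nil_ideal_subset_prime[OF assms(5) P])
    \<comment> \<open>Inserting \<open>carrier B\<close> makes the family visibly nonempty, as
      \<open>i_Intersect\<close> requires, and produces the intersection with
      \<open>carrier B\<close>.\<close>
    have "ideal (\<Inter>(insert (carrier B) (?prim P))) B"
      by (intro i_Intersect) (auto simp: primitive_ideal_def oneideal)
    then show "ideal (carrier B \<inter> \<Inter>(?prim P)) B"
      by simp
    fix x assume "x \<in> carrier B \<inter> \<Inter>(?prim P)"
    then show "\<exists>n::nat. x [^]\<^bsub>B\<^esub> n \<in> P"
      using P by (intro nilpotent_mod_of_integral[OF assms(2,3,4,6)]) (auto simp: prime_ideal_def)
  qed
  have "semiprimitive_ideal I B" if I: "semiprime_ideal I B" for I
    unfolding semiprimitive_ideal_def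
  proof (intro conjI exI)
    show "ideal I B" "\<forall>Q\<in>?prim I. primitive_ideal Q B"
      using I by (auto simp: semiprime_ideal_def)
    \<comment> \<open>For a prime \<open>P\<close> above \<open>I\<close>, every primitive ideal
      above \<open>P\<close> is also above \<open>I\<close>; so the left side lies in the
      intersection for \<open>P\<close>, and \<open>radical\<close> puts that inside
      \<open>P\<close>.\<close>
    have "carrier B \<inter> \<Inter>(?prim I) \<subseteq> ideal_radical B I"
      using radical unfolding ideal_radical_def by blast
    moreover have "I \<subseteq> carrier B"
      using I ideal.Icarr[of I B] by (auto simp: semiprime_ideal_def)
    ultimately show "I = carrier B \<inter> \<Inter>(?prim I)"
      using I by (auto simp: semiprime_ideal_def)
  qed
  then show ?thesis
    using assms(2) by (simp add: jacobson_ring_def)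
qed

end
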